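(* Let $H$ be a Hopf algebra over $\mathbb{C}$ with antipode $S$, let $\mathcal{A}$ be a unital left $H$-module algebra, let $H\ltimes\mathcal{A}$ be their cross-product algebra, and let $\mathcal{C}=\{c\in H\ltimes\mathcal{A} : [c,a]=0\ \text{for all } a\in\mathcal{A}\}$ be the commutant of $\mathcal{A}$ in $H\ltimes\mathcal{A}$. Suppose $\varphi: H\ltimes\mathcal{A}\to\mathcal{A}$ is an algebra homomorphism with $\varphi(a)=a$ for all $a\in\mathcal{A}$. Then the formula $$\zeta(g):=\varphi(S g_{(1)})\, g_{(2)},\qquad g\in H,$$ defines an injective algebra homomorphism $\zeta: H\to\mathcal{C}$. Moreover $$\mathcal{C}=\mathcal{Z}(\mathcal{A})\,\zeta(H)\qquad\text{and}\qquad H\ltimes\mathcal{A}=\mathcal{A}\,\zeta(H),$$ where $\mathcal{Z}(\mathcal{A})$ is the center of $\mathcal{A}$. If in particular $\mathcal{Z}(\mathcal{A})=\mathbb{C}$, then $\mathcal{C}=\zeta(H)$ and $\zeta: H\to\mathcal{C}$ is an algebra isomorphism.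
   Context: Sweedler notation with suppressed summation: $\Delta(g)=g_{(1)}\otimes g_{(2)}$. A left action of $H$ on $\mathcal{A}$, written $g\triangleright a$, makes $\mathcal{A}$ a left $H$-module algebra: $(gg')\triangleright a=g\triangleright(g'\triangleright a)$ and $g\triangleright(aa')=(g_{(1)}\triangleright a)(g_{(2)}\triangleright a')$ (with the usual unit conditions). The cross-product $H\ltimes\mathcal{A}$ is the vector space $\mathcal{A}\otimes H$ with the unital associative product in which $\mathcal{A}\cong\mathcal{A}\otimes 1_H$ and $H\cong 1_{\mathcal{A}}\otimes H$ are subalgebras, $(a\otimes 1_H)(1_{\mathcal{A}}\otimes g)=a\otimes g$ (written $ag$), and $g a=(g_{(1)}\triangleright a)\,g_{(2)}$ for $g\in H$, $a\in\mathcal{A}$. For subspaces $X,Y$ of an algebra, $XY$ denotes the linear span of all products $xy$ with $x\in X$, $y\in Y$. *)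

theory Defs
  imports Complex_Main "HOL-Library.Poly_Mapping"
begin

section \<open>Complex vector spaces and algebras\<close>

class complex_vector = ab_group_add +
  fixes scaleC :: "complex \<Rightarrow> 'a \<Rightarrow> 'a" (infixr \<open>*\<^sub>C\<close> 75)
  assumes scaleC_add_right: "c *\<^sub>C (x + y) = c *\<^sub>C x + c *\<^sub>C y"
    and scaleC_add_left: "(c + d) *\<^sub>C x = c *\<^sub>C x + d *\<^sub>C x"
    and scaleC_scaleC: "c *\<^sub>C d *\<^sub>C x = (c * d) *\<^sub>C x"
    and scaleC_one: "1 *\<^sub>C x = x"

text \<open>Unital associative algebras; being a \<open>ring_1\<close>, such an algebra is non-zero.\<close>

class complex_algebra_1 = complex_vector + ring_1 +
  assumes scaleC_mult_left: "(c *\<^sub>C x) * y = c *\<^sub>C (x * y)"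
    and scaleC_mult_right: "x * (c *\<^sub>C y) = c *\<^sub>C (x * y)"

global_interpretation complex_vector:
  vector_space "scaleC :: complex \<Rightarrow> 'a \<Rightarrow> 'a::complex_vector"
  defines cspan = complex_vector.span
    and csubspace = complex_vector.subspace
  by unfold_locales
    (simp_all add: scaleC_add_right scaleC_add_left scaleC_scaleC scaleC_one)

abbreviation clinear :: "('a::complex_vector \<Rightarrow> 'b::complex_vector) \<Rightarrow> bool"
  where "clinear \<equiv> Vector_Spaces.linear scaleC scaleC"

definition cbilinear ::
  "('a::complex_vector \<Rightarrow> 'b::complex_vector \<Rightarrow> 'c::complex_vector) \<Rightarrow> bool"
  where "cbilinear f \<longleftrightarrow> (\<forall>x. clinear (f x)) \<and> (\<forall>y. clinear (\<lambda>x. f x y))"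

lemma clinear_iff:
  "clinear f \<longleftrightarrow> (\<forall>x y. f (x + y) = f x + f y) \<and> (\<forall>c x. f (c *\<^sub>C x) = c *\<^sub>C f x)"
  by (simp add: Vector_Spaces.linear_iff complex_vector.vector_space_axioms)

instantiation complex :: complex_algebra_1
begin

definition scaleC_complex :: "complex \<Rightarrow> complex \<Rightarrow> complex"
  where "scaleC_complex c z = c * z"

instance
  by standard (simp_all add: scaleC_complex_def algebra_simps)

end

section \<open>Tensor products\<close>

instantiation poly_mapping :: (type, complex_vector) complex_vector
begin

definition scaleC_poly_mapping :: "complex \<Rightarrow> ('a \<Rightarrow>\<^sub>0 'b) \<Rightarrow> 'a \<Rightarrow>\<^sub>0 'b"
  where "scaleC_poly_mapping c = Poly_Mapping.map (scaleC c)"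

lemma lookup_scaleC': "Poly_Mapping.lookup (c *\<^sub>C p) k = c *\<^sub>C Poly_Mapping.lookup p k" for p :: "'a \<Rightarrow>\<^sub>0 'b"
  by (simp add: scaleC_poly_mapping_def Poly_Mapping.map.rep_eq when_def)

instance
  by standard
    (auto intro!: poly_mapping_eqI simp: lookup_scaleC' lookup_add scaleC_add_right
      scaleC_add_left scaleC_scaleC scaleC_one)

end

lemma lookup_scaleC: "Poly_Mapping.lookup (c *\<^sub>C p) k = c *\<^sub>C Poly_Mapping.lookup p k"
  by (rule lookup_scaleC')

text \<open>\<open>('a \<times> 'b) \<Rightarrow>\<^sub>0 complex\<close> is the vector space freely generated by the symbols
  \<open>single (a, b) 1\<close>; the tensor product is its quotient by the bilinearity relations.\<close>

definition tensor_relations ::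
  "(('a::complex_vector \<times> 'b::complex_vector) \<Rightarrow>\<^sub>0 complex) set"
  where "tensor_relations =
    {Poly_Mapping.single (a + a', b) 1 - Poly_Mapping.single (a, b) 1
      - Poly_Mapping.single (a', b) 1 | a a' b. True} \<union>
    {Poly_Mapping.single (a, b + b') 1 - Poly_Mapping.single (a, b) 1
      - Poly_Mapping.single (a, b') 1 | a b b'. True} \<union>
    {Poly_Mapping.single (c *\<^sub>C a, b) 1 - c *\<^sub>C Poly_Mapping.single (a, b) 1 | c a b. True} \<union>
    {Poly_Mapping.single (a, c *\<^sub>C b) 1 - c *\<^sub>C Poly_Mapping.single (a, b) 1 | c a b. True}"

definition tensor_rel ::
  "(('a::complex_vector \<times> 'b::complex_vector) \<Rightarrow>\<^sub>0 complex) \<Rightarrow>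
   (('a \<times> 'b) \<Rightarrow>\<^sub>0 complex) \<Rightarrow> bool"
  where "tensor_rel p q \<longleftrightarrow> p - q \<in> cspan tensor_relations"

lemma equivp_tensor_rel:
  "equivp (tensor_rel :: (('a::complex_vector \<times> 'b::complex_vector) \<Rightarrow>\<^sub>0 complex) \<Rightarrow> _)"
  (is "equivp ?R")
proof (rule equivpI)
  show "reflp ?R"
    by (simp add: reflp_def tensor_rel_def complex_vector.span_zero)
  show "symp ?R"
  proof (rule sympI)
    fix p q :: "('a \<times> 'b) \<Rightarrow>\<^sub>0 complex"
    assume "tensor_rel p q"
    then show "tensor_rel q p"
      unfolding tensor_rel_def by (drule_tac complex_vector.span_neg) simp
  qed
  show "transp ?R"
  proof (rule transpI)
    fix p q r :: "('a \<times> 'b) \<Rightarrow>\<^sub>0 complex"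
    assume "tensor_rel p q" "tensor_rel q r"
    then show "tensor_rel p r"
      unfolding tensor_rel_def by (drule_tac complex_vector.span_add) (assumption, simp)
  qed
qed

lemma tensor_rel_uminus: "tensor_rel p q \<Longrightarrow> tensor_rel (- p) (- q)"
  using complex_vector.span_neg[of "p - q" tensor_relations] by (simp add: tensor_rel_def)

lemma tensor_rel_add: "tensor_rel p q \<Longrightarrow> tensor_rel p' q' \<Longrightarrow> tensor_rel (p + p') (q + q')"
  using complex_vector.span_add[of "p - q" tensor_relations "p' - q'"]
  by (simp add: tensor_rel_def add_diff_add)

lemma tensor_rel_diff: "tensor_rel p q \<Longrightarrow> tensor_rel p' q' \<Longrightarrow> tensor_rel (p - p') (q - q')"
  using tensor_rel_add[OF _ tensor_rel_uminus[of p' q'], of p q] by simp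

lemma tensor_rel_scaleC: "tensor_rel p q \<Longrightarrow> tensor_rel (c *\<^sub>C p) (c *\<^sub>C q)"
  using complex_vector.span_scale[of "p - q" tensor_relations c]
  by (simp add: tensor_rel_def complex_vector.scale_right_diff_distrib)

lemma eq_tensor_relI: "p = q \<Longrightarrow> tensor_rel p q"
  by (simp add: tensor_rel_def complex_vector.span_zero)

quotient_type (overloaded) ('a, 'b) tensor =
  "('a::complex_vector \<times> 'b::complex_vector) \<Rightarrow>\<^sub>0 complex" / tensor_rel
  by (rule equivp_tensor_rel)

instantiation tensor :: (complex_vector, complex_vector) complex_vector
begin

lift_definition zero_tensor :: "('a, 'b) tensor" is 0 .

lift_definition plus_tensor :: "('a, 'b) tensor \<Rightarrow> ('a, 'b) tensor \<Rightarrow> ('a, 'b) tensor"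
  is "(+)"
  by (rule tensor_rel_add)

lift_definition uminus_tensor :: "('a, 'b) tensor \<Rightarrow> ('a, 'b) tensor"
  is uminus
  by (rule tensor_rel_uminus)

lift_definition minus_tensor :: "('a, 'b) tensor \<Rightarrow> ('a, 'b) tensor \<Rightarrow> ('a, 'b) tensor"
  is "(-)"
  by (rule tensor_rel_diff)

lift_definition scaleC_tensor :: "complex \<Rightarrow> ('a, 'b) tensor \<Rightarrow> ('a, 'b) tensor"
  is scaleC
  by (rule tensor_rel_scaleC)

instance
  by standard
    (transfer, rule eq_tensor_relI, simp add: ac_simps scaleC_add_right scaleC_add_left
      scaleC_scaleC scaleC_one)+

end

lift_definition tens :: "'a::complex_vector \<Rightarrow> 'b::complex_vector \<Rightarrow> ('a, 'b) tensor"
  (infixr \<open>\<otimes>\<close> 72) is "\<lambda>a b. Poly_Mapping.single (a, b) 1" .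

lemma cbilinear_tens: "cbilinear tens"
proof -
  have "a \<otimes> (b + b') = a \<otimes> b + a \<otimes> b'" for a :: 'a and b b' :: 'b
    by transfer (unfold tensor_rel_def diff_diff_eq[symmetric], rule complex_vector.span_base,
      unfold tensor_relations_def, blast)
  moreover have "(a + a') \<otimes> b = a \<otimes> b + a' \<otimes> b" for a a' :: 'a and b :: 'b
    by transfer (unfold tensor_rel_def diff_diff_eq[symmetric], rule complex_vector.span_base,
      unfold tensor_relations_def, blast)
  moreover have "a \<otimes> (c *\<^sub>C b) = c *\<^sub>C (a \<otimes> b)" for c and a :: 'a and b :: 'b
    by transfer (unfold tensor_rel_def, rule complex_vector.span_base,
      unfold tensor_relations_def, blast)
  moreover have "(c *\<^sub>C a) \<otimes> b = c *\<^sub>C (a \<otimes> b)" for c and a :: 'a and b :: 'b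
    by transfer (unfold tensor_rel_def, rule complex_vector.span_base,
      unfold tensor_relations_def, blast)
  ultimately show ?thesis
    by (simp add: cbilinear_def clinear_iff)
qed

lemma
  shows tens_add_left: "(a + a') \<otimes> b = a \<otimes> b + a' \<otimes> b"
    and tens_add_right: "a \<otimes> (b + b') = a \<otimes> b + a \<otimes> b'"
    and tens_scaleC_left: "(c *\<^sub>C a) \<otimes> b = c *\<^sub>C (a \<otimes> b)"
    and tens_scaleC_right: "a \<otimes> (c *\<^sub>C b) = c *\<^sub>C (a \<otimes> b)"
  using cbilinear_tens unfolding cbilinear_def clinear_iff by blast+

lemma poly_mapping_free_induct:
  fixes p :: "'k \<Rightarrow>\<^sub>0 complex"
  assumes "P 0" and "\<And>p c k. P p \<Longrightarrow> P (p + c *\<^sub>C Poly_Mapping.single k 1)"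
  shows "P p"
proof (induction p rule: update_induct)
  case const
  then show ?case by (rule assms)
next
  case (update p k c)
  have "Poly_Mapping.update k c p = p + c *\<^sub>C Poly_Mapping.single k 1"
    using update(1) by (intro poly_mapping_eqI)
      (auto simp: lookup_update lookup_add lookup_scaleC lookup_single in_keys_iff
        scaleC_complex_def when_def)
  then show ?case using assms(2) update by metis
qed

lemma tensor_induct [case_names zero add]:
  assumes "P 0" and "\<And>t a b. P t \<Longrightarrow> P (t + a \<otimes> b)"
  shows "P t"
proof (induction t rule: tensor.abs_induct)
  case (1 p)
  show ?case
  proof (induction p rule: poly_mapping_free_induct)
    case 1
    then show ?case using assms(1) by (simp add: zero_tensor_def)
  next
    case (2 p c k)
    obtain a b where k: "k = (a, b)" by force
    have "abs_tensor (p + c *\<^sub>C Poly_Mapping.single k 1) = abs_tensor p + c *\<^sub>C (a \<otimes> b)"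
      by (simp add: k plus_tensor.abs_eq scaleC_tensor.abs_eq tens.abs_eq)
    also have "c *\<^sub>C (a \<otimes> b) = (c *\<^sub>C a) \<otimes> b"
      by (simp add: tens_scaleC_left)
    finally show ?case using assms(2) 2 by metis
  qed
qed

text \<open>The linear map induced by a bilinear map. In Sweedler notation,
  \<open>tensor_lift f (Delta g)\<close> is \<open>f g\<^sub>(\<^sub>1\<^sub>) g\<^sub>(\<^sub>2\<^sub>)\<close>.\<close>

definition tensor_lift ::
  "('a::complex_vector \<Rightarrow> 'b::complex_vector \<Rightarrow> 'c::complex_vector) \<Rightarrow> ('a, 'b) tensor \<Rightarrow> 'c"
  where "tensor_lift f = (THE F. clinear F \<and> (\<forall>a b. F (a \<otimes> b) = f a b))"

lemma clinear_tensor_eqI: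
  fixes F G :: "('a::complex_vector, 'b::complex_vector) tensor \<Rightarrow> 'c::complex_vector"
  assumes "clinear F" "clinear G" "\<And>a b. F (a \<otimes> b) = G (a \<otimes> b)"
  shows "F = G"
proof
  fix t
  have "F 0 = 0" "G 0 = 0"
    using assms(1,2) by (metis clinear_iff add_cancel_right_right)+
  then show "F t = G t"
    using assms by (induction t rule: tensor_induct) (auto simp: clinear_iff)
qed

lemma tensor_lift_ex:
  fixes f :: "'a::complex_vector \<Rightarrow> 'b::complex_vector \<Rightarrow> 'c::complex_vector"
  assumes f: "cbilinear f"
  shows "\<exists>F. clinear F \<and> (\<forall>a b. F (a \<otimes> b) = f a b)"
proof -
  define E :: "(('a \<times> 'b) \<Rightarrow>\<^sub>0 complex) \<Rightarrow> 'c" where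
    "E p = (\<Sum>k\<in>Poly_Mapping.keys p. Poly_Mapping.lookup p k *\<^sub>C case_prod f k)" for p
  have E: "E p = (\<Sum>k\<in>K. Poly_Mapping.lookup p k *\<^sub>C case_prod f k)"
    if "finite K" "Poly_Mapping.keys p \<subseteq> K" for p K
    unfolding E_def using that by (intro sum.mono_neutral_left) (auto simp: in_keys_iff)
  have add: "E (p + q) = E p + E q" for p q
  proof -
    let ?K = "Poly_Mapping.keys p \<union> Poly_Mapping.keys q"
    have "E (p + q) = (\<Sum>k\<in>?K. Poly_Mapping.lookup (p + q) k *\<^sub>C case_prod f k)"
      using Poly_Mapping.keys_add[of p q] by (intro E) auto
    also have "\<dots> = E p + E q"
      by (simp add: E[of ?K p] E[of ?K q] lookup_add scaleC_add_left sum.distrib)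
    finally show ?thesis .
  qed
  have scale: "E (c *\<^sub>C p) = c *\<^sub>C E p" for c p
  proof -
    have "E (c *\<^sub>C p) = (\<Sum>k\<in>Poly_Mapping.keys p. Poly_Mapping.lookup (c *\<^sub>C p) k *\<^sub>C case_prod f k)"
      by (rule E) (auto simp: in_keys_iff lookup_scaleC scaleC_complex_def)
    then show ?thesis
      by (simp add: E_def lookup_scaleC scaleC_complex_def complex_vector.scale_sum_right)
  qed
  have single: "E (Poly_Mapping.single (a, b) 1) = f a b" for a b
    by (simp add: E_def)
  have lin: "clinear E" by (simp add: clinear_iff add scale)
  interpret E: Vector_Spaces.linear scaleC scaleC E by (rule lin)
  have "E p = 0" if "p \<in> cspan tensor_relations" for p
    using that
  proof (induction rule: complex_vector.span_induct_alt)
    case base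
    show ?case by (rule E.zero)
  next
    case (step c x y)
    have "E x = 0"
      using step(1) f unfolding tensor_relations_def
      by (auto simp: E.diff scale single cbilinear_def clinear_iff)
    then show ?case using step by (simp add: add scale)
  qed
  then have wd: "E p = E q" if "tensor_rel p q" for p q
    using that E.diff[of p q] by (simp add: tensor_rel_def)
  define F where "F t = E (rep_tensor t)" for t
  have F: "F (abs_tensor p) = E p" for p
    unfolding F_def using Quotient_rep_abs[OF Quotient_tensor] wd
    by (metis Quotient_tensor Quotient_rel equivp_reflp equivp_tensor_rel)
  have "F (s + t) = F s + F t" for s t
    by (induction s; induction t) (simp add: plus_tensor.abs_eq F add)
  moreover have "F (c *\<^sub>C t) = c *\<^sub>C F t" for c t
    by (induction t) (simp add: scaleC_tensor.abs_eq F scale)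
  moreover have "F (a \<otimes> b) = f a b" for a b
    by (simp add: tens.abs_eq F single)
  ultimately show ?thesis by (auto simp: clinear_iff)
qed

lemma
  assumes "cbilinear f"
  shows clinear_tensor_lift: "clinear (tensor_lift f)"
    and tensor_lift_tens: "tensor_lift f (a \<otimes> b) = f a b"
proof -
  have "\<exists>!F. clinear F \<and> (\<forall>a b. F (a \<otimes> b) = f a b)"
    using tensor_lift_ex[OF assms] by (auto intro!: clinear_tensor_eqI)
  from theI'[OF this]
  show "clinear (tensor_lift f)" "tensor_lift f (a \<otimes> b) = f a b"
    by (simp_all add: tensor_lift_def)
qed

lemma cbilinearI:
  assumes "\<And>y. clinear (\<lambda>x. f x y)" "\<And>x. clinear (\<lambda>y. f x y)"
  shows "cbilinear f"
  using assms by (simp add: cbilinear_def)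

lemma clinear_tensor_lift_arg:
  assumes "\<And>v. clinear (\<lambda>u. f u v)" "\<And>u. clinear (\<lambda>v. f u v)" "clinear g"
  shows "clinear (\<lambda>x. tensor_lift f (g x))"
  using clinear_tensor_lift[OF cbilinearI, of f] assms by (simp add: clinear_iff)

lemma clinear_tensor_lift_fun:
  assumes "\<And>x v. clinear (\<lambda>u. f x u v)" "\<And>x u. clinear (\<lambda>v. f x u v)"
    and "\<And>u v. clinear (\<lambda>x. f x u v)"
  shows "clinear (\<lambda>x. tensor_lift (f x) t)"
proof -
  have lin: "clinear (tensor_lift (f x))" for x
    by (intro clinear_tensor_lift cbilinearI assms)
  have tens: "tensor_lift (f x) (u \<otimes> v) = f x u v" for x u v
    by (intro tensor_lift_tens cbilinearI assms)
  have zero: "tensor_lift (f x) 0 = 0" for x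
    using lin[of x] by (metis clinear_iff add_cancel_right_right)
  have "tensor_lift (f (x + y)) t = tensor_lift (f x) t + tensor_lift (f y) t" for x y
    using lin assms(3)
    by (induction t rule: tensor_induct) (simp_all add: zero clinear_iff tens algebra_simps)
  moreover have "tensor_lift (f (c *\<^sub>C x)) t = c *\<^sub>C tensor_lift (f x) t" for c x
    using lin assms(3)
    by (induction t rule: tensor_induct)
      (simp_all add: zero clinear_iff tens scaleC_add_right)
  ultimately show ?thesis by (simp add: clinear_iff)
qed

lemma clinear_tens_left: "clinear f \<Longrightarrow> clinear (\<lambda>x. f x \<otimes> b)"
  by (simp add: clinear_iff tens_add_left tens_scaleC_left)

lemma clinear_tens_right: "clinear f \<Longrightarrow> clinear (\<lambda>x. a \<otimes> f x)"
  by (simp add: clinear_iff tens_add_right tens_scaleC_right)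

lemma clinear_mult_left: "clinear f \<Longrightarrow> clinear (\<lambda>x. f x * b)"
  for b :: "'a::complex_algebra_1"
  by (simp add: clinear_iff distrib_right scaleC_mult_left)

lemma clinear_mult_right: "clinear f \<Longrightarrow> clinear (\<lambda>x. a * f x)"
  for a :: "'a::complex_algebra_1"
  by (simp add: clinear_iff distrib_left scaleC_mult_right)

lemma clinear_id: "clinear (\<lambda>x. x)"
  by (simp add: clinear_iff)

lemmas clinear_intros = clinear_id clinear_tens_left clinear_tens_right clinear_mult_left
  clinear_mult_right clinear_tensor_lift_arg clinear_tensor_lift_fun

lemma clinear_tensor_lift_commute:
  assumes "clinear F" "\<And>v. clinear (\<lambda>u. f u v)" "\<And>u. clinear (\<lambda>v. f u v)"
  shows "F (tensor_lift f t) = tensor_lift (\<lambda>u v. F (f u v)) t"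
proof -
  have *: "cbilinear f" "cbilinear (\<lambda>u v. F (f u v))"
    using assms by (simp_all add: cbilinear_def clinear_iff)
  have "(\<lambda>t. F (tensor_lift f t)) = tensor_lift (\<lambda>u v. F (f u v))"
    using assms(1) clinear_tensor_lift[OF *(1)]
    by (intro clinear_tensor_eqI clinear_tensor_lift *)
      (simp_all add: clinear_iff tensor_lift_tens *)
  then show ?thesis by metis
qed

definition tensor_map ::
  "('a::complex_vector \<Rightarrow> 'c::complex_vector) \<Rightarrow> ('b::complex_vector \<Rightarrow> 'd::complex_vector) \<Rightarrow>
   ('a, 'b) tensor \<Rightarrow> ('c, 'd) tensor"
  where "tensor_map f g = tensor_lift (\<lambda>a b. f a \<otimes> g b)"

definition tensor_assoc ::
  "(('a::complex_vector, 'b::complex_vector) tensor, 'c::complex_vector) tensor \<Rightarrow>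
   ('a, ('b, 'c) tensor) tensor"
  where "tensor_assoc = tensor_lift (\<lambda>t c. tensor_lift (\<lambda>a b. a \<otimes> (b \<otimes> c)) t)"

text \<open>The factorwise product of the tensor product algebra.\<close>

definition tensor_mult ::
  "('a::complex_algebra_1, 'b::complex_algebra_1) tensor \<Rightarrow> ('a, 'b) tensor \<Rightarrow> ('a, 'b) tensor"
  where "tensor_mult s t =
    tensor_lift (\<lambda>a b. tensor_lift (\<lambda>a' b'. (a * a') \<otimes> (b * b')) t) s"

section \<open>Algebra structures given by an explicit product\<close>

text \<open>The vector space \<open>('a, 'h) tensor\<close> carries several products (factorwise,
  cross-product), so the product and the unit are passed explicitly.\<close>

definition unital_algebra :: "('b::complex_vector \<Rightarrow> 'b \<Rightarrow> 'b) \<Rightarrow> 'b \<Rightarrow> bool"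
  where "unital_algebra m u \<longleftrightarrow> cbilinear m \<and>
    (\<forall>x y z. m (m x y) z = m x (m y z)) \<and> (\<forall>x. m u x = x \<and> m x u = x)"

definition algebra_hom ::
  "('b::complex_vector \<Rightarrow> 'b \<Rightarrow> 'b) \<Rightarrow> 'b \<Rightarrow> ('c::complex_vector \<Rightarrow> 'c \<Rightarrow> 'c) \<Rightarrow> 'c \<Rightarrow>
   ('b \<Rightarrow> 'c) \<Rightarrow> bool"
  where "algebra_hom m u m' u' f \<longleftrightarrow>
    clinear f \<and> (\<forall>x y. f (m x y) = m' (f x) (f y)) \<and> f u = u'"

definition subalgebra :: "('b::complex_vector \<Rightarrow> 'b \<Rightarrow> 'b) \<Rightarrow> 'b \<Rightarrow> 'b set \<Rightarrow> bool"
  where "subalgebra m u X \<longleftrightarrow> csubspace X \<and> (\<forall>x\<in>X. \<forall>y\<in>X. m x y \<in> X) \<and> u \<in> X"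

definition span_mult :: "('b::complex_vector \<Rightarrow> 'b \<Rightarrow> 'b) \<Rightarrow> 'b set \<Rightarrow> 'b set \<Rightarrow> 'b set"
  where "span_mult m X Y = cspan {m x y | x y. x \<in> X \<and> y \<in> Y}"

definition center :: "'a::complex_algebra_1 set"
  where "center = {z. \<forall>a. z * a = a * z}"

section \<open>Hopf algebras, module algebras and cross-products\<close>

locale hopf_algebra =
  fixes Delta :: "'h::complex_algebra_1 \<Rightarrow> ('h, 'h) tensor"
    and counit :: "'h \<Rightarrow> complex"
    and antipode :: "'h \<Rightarrow> 'h"
  assumes Delta_hom: "algebra_hom (*) 1 tensor_mult (1 \<otimes> 1) Delta"
    and counit_hom: "algebra_hom (*) 1 (*) 1 counit"
    and coassoc: "tensor_assoc (tensor_map Delta id (Delta g)) = tensor_map id Delta (Delta g)"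
    and counit_left: "tensor_lift (\<lambda>g1 g2. counit g1 *\<^sub>C g2) (Delta g) = g"
    and counit_right: "tensor_lift (\<lambda>g1 g2. counit g2 *\<^sub>C g1) (Delta g) = g"
    and antipode_linear: "clinear antipode"
    and antipode_left: "tensor_lift (\<lambda>g1 g2. antipode g1 * g2) (Delta g) = counit g *\<^sub>C 1"
    and antipode_right: "tensor_lift (\<lambda>g1 g2. g1 * antipode g2) (Delta g) = counit g *\<^sub>C 1"

locale module_algebra = hopf_algebra Delta counit antipode
  for Delta :: "'h::complex_algebra_1 \<Rightarrow> ('h, 'h) tensor"
    and counit :: "'h \<Rightarrow> complex"
    and antipode :: "'h \<Rightarrow> 'h" +
  fixes act :: "'h \<Rightarrow> 'a::complex_algebra_1 \<Rightarrow> 'a"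
  assumes act_bilinear: "cbilinear act"
    and act_one_left: "act 1 a = a"
    and act_mult_left: "act (g * g') a = act g (act g' a)"
    and act_one_right: "act g 1 = counit g *\<^sub>C 1"
    and act_mult_right:
      "act g (a * a') = tensor_lift (\<lambda>g1 g2. act g1 a * act g2 a') (Delta g)"

text \<open>The product \<open>(a \<otimes> g) (b \<otimes> h) = a (g\<^sub>(\<^sub>1\<^sub>) \<triangleright> b) \<otimes> g\<^sub>(\<^sub>2\<^sub>) h\<close>, as forced by the
  relations \<open>a g = a \<otimes> g\<close> and \<open>g b = (g\<^sub>(\<^sub>1\<^sub>) \<triangleright> b) g\<^sub>(\<^sub>2\<^sub>)\<close>; see
  \<open>cross_mult_algebra\<close>, \<open>cross_mult_relations\<close> and \<open>cross_mult_unique\<close> below.\<close>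

definition cross_mult ::
  "('h::complex_algebra_1 \<Rightarrow> ('h, 'h) tensor) \<Rightarrow> ('h \<Rightarrow> 'a::complex_algebra_1 \<Rightarrow> 'a) \<Rightarrow>
   ('a, 'h) tensor \<Rightarrow> ('a, 'h) tensor \<Rightarrow> ('a, 'h) tensor"
  where "cross_mult Delta act s t =
    tensor_lift (\<lambda>a g. tensor_lift (\<lambda>b h.
      tensor_lift (\<lambda>g1 g2. (a * act g1 b) \<otimes> (g2 * h)) (Delta g)) t) s"

definition commutant ::
  "('h::complex_algebra_1 \<Rightarrow> ('h, 'h) tensor) \<Rightarrow> ('h \<Rightarrow> 'a::complex_algebra_1 \<Rightarrow> 'a) \<Rightarrow>
   ('a, 'h) tensor set"
  where "commutant Delta act =
    {c. \<forall>a. cross_mult Delta act c (a \<otimes> 1) - cross_mult Delta act (a \<otimes> 1) c = 0}"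

definition zeta ::
  "('h::complex_algebra_1 \<Rightarrow> ('h, 'h) tensor) \<Rightarrow> ('h \<Rightarrow> 'h) \<Rightarrow>
   ('h \<Rightarrow> 'a::complex_algebra_1 \<Rightarrow> 'a) \<Rightarrow> (('a, 'h) tensor \<Rightarrow> 'a) \<Rightarrow> 'h \<Rightarrow> ('a, 'h) tensor"
  where "zeta Delta antipode act \<phi> g =
    tensor_lift (\<lambda>g1 g2. cross_mult Delta act (\<phi> (1 \<otimes> antipode g1) \<otimes> 1) (1 \<otimes> g2)) (Delta g)"

subsection \<open>The cross-product is an algebra, determined by its relations\<close>

context module_algebra
begin

lemma clinear_Delta: "clinear f \<Longrightarrow> clinear (\<lambda>x. Delta (f x))"
  using Delta_hom by (simp add: algebra_hom_def clinear_iff)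

lemma clinear_act_left: "clinear f \<Longrightarrow> clinear (\<lambda>x. act (f x) a)"
  using act_bilinear by (simp add: cbilinear_def clinear_iff)

lemma clinear_act_right: "clinear f \<Longrightarrow> clinear (\<lambda>x. act g (f x))"
  using act_bilinear by (simp add: cbilinear_def clinear_iff)

lemmas lin = clinear_intros clinear_Delta clinear_act_left clinear_act_right

lemma clinear_cross_mult_left: "clinear f \<Longrightarrow> clinear (\<lambda>x. cross_mult Delta act (f x) t)"
  unfolding cross_mult_def by (intro lin)

lemma clinear_cross_mult_right: "clinear f \<Longrightarrow> clinear (\<lambda>x. cross_mult Delta act s (f x))"
  unfolding cross_mult_def by (intro lin)

lemmas lin' = lin clinear_cross_mult_left clinear_cross_mult_right

lemma cross_mult_tens:
  "cross_mult Delta act (a \<otimes> g) (b \<otimes> h) =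
    tensor_lift (\<lambda>g1 g2. (a * act g1 b) \<otimes> (g2 * h)) (Delta g)"
  unfolding cross_mult_def
  by (subst tensor_lift_tens, intro cbilinearI lin)+ simp

lemma coassoc_lift:
  assumes "\<And>y z. clinear (\<lambda>x. f x y z)" "\<And>x z. clinear (\<lambda>y. f x y z)"
    and "\<And>x y. clinear (\<lambda>z. f x y z)"
  shows "tensor_lift (\<lambda>g1 g2. tensor_lift (\<lambda>x y. f x y g2) (Delta g1)) (Delta g) =
    tensor_lift (\<lambda>g1 g2. tensor_lift (f g1) (Delta g2)) (Delta g)"
proof -
  define F where "F = tensor_lift (\<lambda>x t. tensor_lift (f x) t)"
  have F: "clinear F" unfolding F_def by (intro clinear_tensor_lift cbilinearI lin assms)
  have F_tens: "F (x \<otimes> t) = tensor_lift (f x) t" for x t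
    unfolding F_def by (intro tensor_lift_tens cbilinearI lin assms)
  have f_tens: "tensor_lift (f x) (y \<otimes> z) = f x y z" for x y z
    by (intro tensor_lift_tens cbilinearI assms)
  have assoc: "tensor_assoc (t \<otimes> z) = tensor_lift (\<lambda>x y. x \<otimes> (y \<otimes> z)) t"
    for t :: "('h, 'h) tensor" and z :: 'h
    unfolding tensor_assoc_def by (intro tensor_lift_tens cbilinearI lin)
  have assoc_lin: "clinear (tensor_assoc :: (('h, 'h) tensor, 'h) tensor \<Rightarrow> _)"
    unfolding tensor_assoc_def by (intro clinear_tensor_lift cbilinearI lin)
  have "tensor_lift (\<lambda>g1 g2. tensor_lift (\<lambda>x y. f x y g2) (Delta g1)) (Delta g) =
      tensor_lift (\<lambda>g1 g2. F (tensor_assoc (Delta g1 \<otimes> g2))) (Delta g)"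
    by (simp add: assoc clinear_tensor_lift_commute[OF F] lin F_tens f_tens)
  also have "\<dots> = F (tensor_assoc (tensor_map Delta id (Delta g)))"
    unfolding tensor_map_def id_def
    using F assoc_lin
    by (subst clinear_tensor_lift_commute[where F = "\<lambda>t. F (tensor_assoc t)"])
      (simp add: clinear_iff, intro lin, intro lin, simp)
  also have "\<dots> = F (tensor_map id Delta (Delta g))"
    by (simp add: coassoc)
  also have "\<dots> = tensor_lift (\<lambda>g1 g2. tensor_lift (f g1) (Delta g2)) (Delta g)"
    unfolding tensor_map_def id_def
    by (subst clinear_tensor_lift_commute[OF F]) (intro lin, intro lin, simp add: F_tens)
  finally show ?thesis .
qed

lemma tensor_lift_swap:
  assumes "\<And>y u v. clinear (\<lambda>x. f x y u v)" "\<And>x u v. clinear (\<lambda>y. f x y u v)"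
    and "\<And>x y v. clinear (\<lambda>u. f x y u v)" "\<And>x y u. clinear (\<lambda>v. f x y u v)"
  shows "tensor_lift (\<lambda>x y. tensor_lift (f x y) t) s =
    tensor_lift (\<lambda>u v. tensor_lift (\<lambda>x y. f x y u v) s) t"
proof -
  have tens: "tensor_lift (f x y) (u \<otimes> v) = f x y u v" for x y u v
    by (intro tensor_lift_tens cbilinearI assms)
  have *: "cbilinear (\<lambda>u v. tensor_lift (\<lambda>x y. f x y u v) s)"
    by (intro cbilinearI lin assms)
  have "(\<lambda>t. tensor_lift (\<lambda>x y. tensor_lift (f x y) t) s) =
      tensor_lift (\<lambda>u v. tensor_lift (\<lambda>x y. f x y u v) s)"
  proof (rule clinear_tensor_eqI)
    show "clinear (\<lambda>t. tensor_lift (\<lambda>x y. tensor_lift (f x y) t) s)"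
      by (intro lin assms)
  qed (simp_all add: clinear_tensor_lift tensor_lift_tens * tens)
  then show ?thesis by metis
qed

lemma cross_mult_assoc_tens:
  "cross_mult Delta act (cross_mult Delta act (a \<otimes> g) (b \<otimes> h)) (c \<otimes> k) =
   cross_mult Delta act (a \<otimes> g) (cross_mult Delta act (b \<otimes> h) (c \<otimes> k))"
proof -
  define Q where "Q x y z =
    tensor_lift (\<lambda>h1 h2. (a * (act x b * act y (act h1 c))) \<otimes> (z * (h2 * k))) (Delta h)"
    for x y z
  have Q: "clinear (\<lambda>x. Q x y z)" "clinear (\<lambda>y. Q x y z)" "clinear (\<lambda>z. Q x y z)" for x y z
    unfolding Q_def by (intro lin)+
  have Delta_mult: "Delta (x * y) = tensor_mult (Delta x) (Delta y)" for x y
    using Delta_hom by (simp add: algebra_hom_def)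
  have "tensor_lift (\<lambda>u v. (a * act x b * act u c) \<otimes> (v * k)) (Delta (z * h)) =
      tensor_lift (Q x) (Delta z)" for x z
  proof -
    define F where "F = tensor_lift (\<lambda>u v. (a * act x b * act u c) \<otimes> (v * k))"
    have F: "clinear F"
      unfolding F_def by (intro clinear_tensor_lift cbilinearI lin)
    have F_tens: "F (u \<otimes> v) = (a * act x b * act u c) \<otimes> (v * k)" for u v
      unfolding F_def by (intro tensor_lift_tens cbilinearI lin)
    have "F (Delta (z * h)) = tensor_lift (\<lambda>g1 g2. F (tensor_lift
        (\<lambda>h1 h2. (g1 * h1) \<otimes> (g2 * h2)) (Delta h))) (Delta z)"
      unfolding Delta_mult tensor_mult_def
      by (rule clinear_tensor_lift_commute[OF F]) (intro lin)+
    moreover have "F (tensor_lift (\<lambda>h1 h2. (g1 * h1) \<otimes> (g2 * h2)) (Delta h)) = Q x g1 g2" for g1 g2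
      by (subst clinear_tensor_lift_commute[OF F])
        (intro lin, intro lin, simp add: F_tens Q_def act_mult_left mult.assoc)
    ultimately have "F (Delta (z * h)) = tensor_lift (Q x) (Delta z)"
      by simp
    then show ?thesis
      by (simp add: F_def)
  qed
  note step = this
  have "cross_mult Delta act (cross_mult Delta act (a \<otimes> g) (b \<otimes> h)) (c \<otimes> k) =
      tensor_lift (\<lambda>x z. cross_mult Delta act ((a * act x b) \<otimes> (z * h)) (c \<otimes> k)) (Delta g)"
    unfolding cross_mult_tens[of a g]
    by (rule clinear_tensor_lift_commute) (intro lin')+
  also have "\<dots> = tensor_lift (\<lambda>x z. tensor_lift (Q x) (Delta z)) (Delta g)"
    unfolding cross_mult_tens step ..
  also have "\<dots> = tensor_lift (\<lambda>z g2. tensor_lift (\<lambda>x y. Q x y g2) (Delta z)) (Delta g)"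
    by (rule coassoc_lift[symmetric]) (rule Q)+
  also have "\<dots> = tensor_lift (\<lambda>z g2. tensor_lift (\<lambda>h1 h2.
      (a * act z (b * act h1 c)) \<otimes> (g2 * (h2 * k))) (Delta h)) (Delta g)"
  proof -
    have "tensor_lift (\<lambda>x y. Q x y g2) (Delta z) =
        tensor_lift (\<lambda>h1 h2. (a * act z (b * act h1 c)) \<otimes> (g2 * (h2 * k))) (Delta h)" for z g2
    proof -
      have "(a * act z (b * act h1 c)) \<otimes> (g2 * (h2 * k)) = tensor_lift (\<lambda>x y.
          (a * (act x b * act y (act h1 c))) \<otimes> (g2 * (h2 * k))) (Delta z)" for h1 h2
        unfolding act_mult_right
        by (rule clinear_tensor_lift_commute[where F = "\<lambda>t. (a * t) \<otimes> (g2 * (h2 * k))"])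
          (intro lin)+
      then show ?thesis
        unfolding Q_def by (simp only:) (rule tensor_lift_swap; intro lin)
    qed
    then show ?thesis by (simp only:)
  qed
  also have "\<dots> = tensor_lift (\<lambda>h1 h2. tensor_lift (\<lambda>z g2.
      (a * act z (b * act h1 c)) \<otimes> (g2 * (h2 * k))) (Delta g)) (Delta h)"
    by (rule tensor_lift_swap) (intro lin)+
  also have "\<dots> = cross_mult Delta act (a \<otimes> g) (cross_mult Delta act (b \<otimes> h) (c \<otimes> k))"
  proof -
    have "cross_mult Delta act (a \<otimes> g) (cross_mult Delta act (b \<otimes> h) (c \<otimes> k)) =
        tensor_lift (\<lambda>h1 h2. cross_mult Delta act (a \<otimes> g) ((b * act h1 c) \<otimes> (h2 * k))) (Delta h)"
      unfolding cross_mult_tens[of b h]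
      by (rule clinear_tensor_lift_commute) (intro lin')+
    then show ?thesis
      by (simp only: cross_mult_tens)
  qed
  finally show ?thesis .
qed

lemma cross_mult_algebra: "unital_algebra (cross_mult Delta act) (1 \<otimes> 1)"
proof -
  let ?m = "cross_mult Delta act :: ('a, 'h) tensor \<Rightarrow> _"
  have one: "Delta 1 = 1 \<otimes> 1"
    using Delta_hom by (simp add: algebra_hom_def)
  have bil: "cbilinear ?m"
    by (intro cbilinearI lin')
  have ext: "F = G" if "clinear F" "clinear G" "\<And>a g. F (a \<otimes> g) = G (a \<otimes> g)"
    for F G :: "('a, 'h) tensor \<Rightarrow> ('a, 'h) tensor"
    using that by (rule clinear_tensor_eqI)
  have "(\<lambda>z. ?m (?m (a \<otimes> g) (b \<otimes> h)) z) = (\<lambda>z. ?m (a \<otimes> g) (?m (b \<otimes> h) z))" for a g b h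
    by (rule ext) (intro lin', intro lin', rule cross_mult_assoc_tens)
  then have "(\<lambda>y. ?m (?m (a \<otimes> g) y) z) = (\<lambda>y. ?m (a \<otimes> g) (?m y z))" for a g z
    by (intro ext) (intro lin', intro lin', metis)
  then have "(\<lambda>x. ?m (?m x y) z) = (\<lambda>x. ?m x (?m y z))" for y z
    by (intro ext) (intro lin', intro lin', metis)
  then have assoc: "?m (?m x y) z = ?m x (?m y z)" for x y z
    by metis
  have "(\<lambda>x. ?m (1 \<otimes> 1) x) = (\<lambda>x. x)"
    by (rule ext) (intro lin', intro lin',
      simp add: cross_mult_tens one tensor_lift_tens cbilinearI lin act_one_left)
  moreover have "(\<lambda>x. ?m x (1 \<otimes> 1)) = (\<lambda>x. x)"
  proof (rule ext)
    fix a :: 'a and g :: 'h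
    have "?m (a \<otimes> g) (1 \<otimes> 1) = tensor_lift (\<lambda>g1 g2. a \<otimes> (counit g1 *\<^sub>C g2)) (Delta g)"
      by (simp add: cross_mult_tens act_one_right scaleC_mult_right tens_scaleC_left
          tens_scaleC_right)
    also have "\<dots> = a \<otimes> tensor_lift (\<lambda>g1 g2. counit g1 *\<^sub>C g2) (Delta g)"
      using counit_hom
      by (intro clinear_tensor_lift_commute[symmetric] lin)
        (simp_all add: clinear_iff algebra_hom_def scaleC_add_left scaleC_add_right
          scaleC_scaleC scaleC_complex_def mult.commute)
    finally show "?m (a \<otimes> g) (1 \<otimes> 1) = a \<otimes> g"
      by (simp add: counit_left)
  qed (intro lin')+
  ultimately show ?thesis
    using bil assoc unfolding unital_algebra_def by metis
qed

lemma cross_mult_relations: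
  "cross_mult Delta act (a \<otimes> 1) (1 \<otimes> g) = a \<otimes> g"
  "cross_mult Delta act (a \<otimes> 1) (b \<otimes> 1) = (a * b) \<otimes> 1"
  "cross_mult Delta act (1 \<otimes> g) (1 \<otimes> h) = 1 \<otimes> (g * h)"
  "cross_mult Delta act (1 \<otimes> g) (a \<otimes> 1) =
    tensor_lift (\<lambda>g1 g2. cross_mult Delta act (act g1 a \<otimes> 1) (1 \<otimes> g2)) (Delta g)"
proof -
  have one: "Delta 1 = 1 \<otimes> 1"
    using Delta_hom by (simp add: algebra_hom_def)
  have 1: "cross_mult Delta act (a \<otimes> 1) (b \<otimes> g) = (a * b) \<otimes> g" for a b g
    by (simp add: cross_mult_tens one tensor_lift_tens cbilinearI lin act_one_left)
  show "cross_mult Delta act (a \<otimes> 1) (1 \<otimes> g) = a \<otimes> g"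
    "cross_mult Delta act (a \<otimes> 1) (b \<otimes> 1) = (a * b) \<otimes> 1"
    by (simp_all add: 1)
  show "cross_mult Delta act (1 \<otimes> g) (a \<otimes> 1) =
      tensor_lift (\<lambda>g1 g2. cross_mult Delta act (act g1 a \<otimes> 1) (1 \<otimes> g2)) (Delta g)"
    by (simp add: 1) (simp add: cross_mult_tens)
  have "cross_mult Delta act (1 \<otimes> g) (1 \<otimes> h) =
      tensor_lift (\<lambda>g1 g2. 1 \<otimes> ((counit g1 *\<^sub>C g2) * h)) (Delta g)"
    by (simp add: cross_mult_tens act_one_right scaleC_mult_left tens_scaleC_left
        tens_scaleC_right)
  also have "\<dots> = 1 \<otimes> (tensor_lift (\<lambda>g1 g2. counit g1 *\<^sub>C g2) (Delta g) * h)"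
    using counit_hom
    by (intro clinear_tensor_lift_commute[symmetric] lin)
      (simp_all add: clinear_iff algebra_hom_def scaleC_add_left scaleC_add_right
        scaleC_scaleC scaleC_complex_def mult.commute)
  finally show "cross_mult Delta act (1 \<otimes> g) (1 \<otimes> h) = 1 \<otimes> (g * h)"
    by (simp add: counit_left)
qed

lemma cross_mult_unique:
  fixes m :: "('a, 'h) tensor \<Rightarrow> ('a, 'h) tensor \<Rightarrow> ('a, 'h) tensor"
  assumes bil: "cbilinear m" and assoc: "\<And>x y z. m (m x y) z = m x (m y z)"
    and mixed: "\<And>a g. m (a \<otimes> 1) (1 \<otimes> g) = a \<otimes> g"
    and left: "\<And>a b. m (a \<otimes> 1) (b \<otimes> 1) = (a * b) \<otimes> 1"
    and right: "\<And>g h. m (1 \<otimes> g) (1 \<otimes> h) = 1 \<otimes> (g * h)"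
    and cross: "\<And>g a. m (1 \<otimes> g) (a \<otimes> 1) =
      tensor_lift (\<lambda>g1 g2. m (act g1 a \<otimes> 1) (1 \<otimes> g2)) (Delta g)"
  shows "m = cross_mult Delta act"
proof -
  have m_left: "clinear f \<Longrightarrow> clinear (\<lambda>x. m (f x) t)"
    and m_right: "clinear f \<Longrightarrow> clinear (\<lambda>x. m t (f x))" for f t
    using bil by (simp_all add: cbilinear_def clinear_iff)
  have 1: "m (a \<otimes> 1) (m (b \<otimes> g) (1 \<otimes> h)) = (a * b) \<otimes> (g * h)" for a b g h
    by (metis assoc mixed left right)
  have "m (a \<otimes> g) (b \<otimes> h) = m (a \<otimes> 1) (m (m (1 \<otimes> g) (b \<otimes> 1)) (1 \<otimes> h))" for a g b h
    by (metis assoc mixed)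
  moreover have "m (a \<otimes> 1) (m (m (1 \<otimes> g) (b \<otimes> 1)) (1 \<otimes> h)) =
      cross_mult Delta act (a \<otimes> g) (b \<otimes> h)" for a g b h
    unfolding cross mixed
    by (subst clinear_tensor_lift_commute[where F = "\<lambda>t. m (a \<otimes> 1) (m t (1 \<otimes> h))"])
      (intro m_left m_right lin, intro lin, intro lin, simp add: 1 cross_mult_tens)
  ultimately have "(\<lambda>t. m (a \<otimes> g) t) = (\<lambda>t. cross_mult Delta act (a \<otimes> g) t)" for a g
    by (intro clinear_tensor_eqI) (intro m_right lin', intro lin', simp)
  then have "(\<lambda>s. m s t) = (\<lambda>s. cross_mult Delta act s t)" for t
    by (intro clinear_tensor_eqI) (intro m_left lin', intro lin', metis)
  then show ?thesis by (intro ext) metis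
qed

end

end

theory Submission
  imports Defs
begin

text \<open>Write \<open>\<pi> g = \<phi> (1 \<otimes> g)\<close> for the algebra homomorphism \<open>H \<rightarrow> A\<close> obtained by restricting
  \<open>\<phi>\<close>, and \<open>\<pi>' = \<pi> \<circ> S\<close>. By the antipode axioms \<open>\<pi>'\<close> is the inverse of \<open>\<pi>\<close> for the
  convolution product, and \<open>\<zeta> g = \<pi>' g\<^sub>(\<^sub>1\<^sub>) \<otimes> g\<^sub>(\<^sub>2\<^sub>)\<close> is the convolution of \<open>\<pi>'\<close> with the
  inclusion of \<open>H\<close>. Applying \<open>\<phi>\<close> to the cross relation \<open>g a = (g\<^sub>(\<^sub>1\<^sub>) \<triangleright> a) g\<^sub>(\<^sub>2\<^sub>)\<close> gives
  \<open>\<pi> g a = (g\<^sub>(\<^sub>1\<^sub>) \<triangleright> a) \<pi> g\<^sub>(\<^sub>2\<^sub>)\<close>, that is, \<open>\<pi>\<close> makes the action inner. Convolving with \<open>\<pi>'\<close> on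
  both sides turns this into \<open>\<pi>' g\<^sub>(\<^sub>1\<^sub>) (g\<^sub>(\<^sub>2\<^sub>) \<triangleright> a) = a \<pi>' g\<close> (\<open>conv_pi'_act\<close>), which is
  exactly what makes \<open>\<zeta> g\<close> commute with \<open>a\<close> (\<open>zeta_commutes\<close>).

  Since \<open>\<pi>'\<close> is invertible, \<open>\<zeta>\<close> is characterised by \<open>\<pi> g\<^sub>(\<^sub>1\<^sub>) \<zeta> g\<^sub>(\<^sub>2\<^sub>) = g\<close>. Multiplicativity
  (\<open>zeta_mult\<close>) is obtained by cancelling \<open>\<pi>\<close> in this identity, once for each factor, which
  works because \<open>\<pi>\<close> itself is multiplicative.

  The same inversion shows that \<open>a \<otimes> h \<mapsto> a \<zeta> h\<close> is a linear automorphism of \<open>A \<otimes> H\<close>, with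
  inverse \<open>a \<otimes> h \<mapsto> a \<pi> h\<^sub>(\<^sub>1\<^sub>) \<otimes> h\<^sub>(\<^sub>2\<^sub>)\<close>. So the cross-product is \<open>A \<zeta>(H)\<close>, and \<open>\<zeta>\<close> is
  injective because \<open>h \<mapsto> 1 \<otimes> h\<close> is. As \<open>\<zeta>(H)\<close> commutes with \<open>A\<close>, this automorphism carries
  \<open>[x, a] \<otimes> h\<close> to \<open>[x \<zeta> h, a]\<close>; hence it identifies the commutant with the tensors killed by all
  \<open>[_, a] \<otimes> id\<close>. Expanding such a tensor along a basis of \<open>H\<close> shows that its coefficients are
  central (\<open>central_slices\<close>), so the commutant is \<open>Z(A) \<zeta>(H)\<close>.\<close>

section \<open>Coordinates in tensor products\<close>

lemma clinear_compose: "clinear f \<Longrightarrow> clinear g \<Longrightarrow> clinear (\<lambda>x. f (g x))"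
  by (simp add: clinear_iff)

lemma clinear_zero: "clinear f \<Longrightarrow> f 0 = 0"
  by (metis clinear_iff add_cancel_right_right)

lemma clinear_diff: "clinear f \<Longrightarrow> f (x - y) = f x - f y"
  by (metis clinear_iff eq_diff_eq)

lemma clinear_sum: "clinear f \<Longrightarrow> f (\<Sum>i\<in>I. g i) = (\<Sum>i\<in>I. f (g i))"
  by (induction I rule: infinite_finite_induct) (simp_all add: clinear_zero clinear_iff)

lemma cbilinear_left: "cbilinear d \<Longrightarrow> clinear f \<Longrightarrow> clinear (\<lambda>x. d (f x) y)"
  by (simp add: cbilinear_def clinear_iff)

lemma cbilinear_right: "cbilinear d \<Longrightarrow> clinear f \<Longrightarrow> clinear (\<lambda>x. d y (f x))"
  by (simp add: cbilinear_def clinear_iff)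

lemma bilinear_mult: "cbilinear ((*) :: 'b::complex_algebra_1 \<Rightarrow> 'b \<Rightarrow> 'b)"
  by (intro cbilinearI clinear_intros)

lemma clinear_coordinate:
  assumes "\<not> complex_vector.dependent B" "cspan B = UNIV"
  shows "clinear (\<lambda>x. complex_vector.representation B x b)"
  using assms
  by (simp add: clinear_iff complex_vector.representation_add
      complex_vector.representation_scale scaleC_complex_def)

lemma clinear_scaleC_left: "clinear f \<Longrightarrow> clinear (\<lambda>x. f x *\<^sub>C a)"
  by (simp add: clinear_iff scaleC_add_left scaleC_scaleC scaleC_complex_def)

lemma clinear_scaleC_right: "clinear f \<Longrightarrow> clinear (\<lambda>x. c *\<^sub>C f x)"
  by (simp add: clinear_iff scaleC_add_right scaleC_scaleC mult.commute)

text \<open>A linear functional that is \<open>1\<close> at \<open>a\<close>, taken as a coordinate in a basis containing \<open>a\<close>,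
  recovers \<open>h\<close> from \<open>a \<otimes> h\<close>.\<close>

lemma tens_eq_zero_right:
  fixes a :: "'a::complex_vector" and h :: "'b::complex_vector"
  assumes "a \<noteq> 0" "a \<otimes> h = 0"
  shows "h = 0"
proof -
  define B where "B = complex_vector.extend_basis {a}"
  have a: "\<not> complex_vector.dependent {a}"
    using assms(1) by (simp add: complex_vector.dependent_single)
  have B: "\<not> complex_vector.dependent B" "cspan B = UNIV"
    using complex_vector.independent_extend_basis[OF a] complex_vector.span_extend_basis[OF a]
    by (simp_all add: B_def)
  have aB: "a \<in> B"
    using complex_vector.extend_basis_superset[OF a] by (simp add: B_def)
  define f where "f x = complex_vector.representation B x a" for x
  have f: "clinear f"
    unfolding f_def by (rule clinear_coordinate[OF B])
  have "cbilinear (\<lambda>x (y::'b). f x *\<^sub>C y)"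
    by (intro cbilinearI clinear_scaleC_left clinear_scaleC_right clinear_id f)
  from tensor_lift_tens[OF this, of a h] clinear_zero[OF clinear_tensor_lift[OF this]]
  have "f a *\<^sub>C h = 0"
    using assms(2) by simp
  then show ?thesis
    using complex_vector.representation_basis[OF B(1) aB] by (simp add: f_def scaleC_one)
qed

text \<open>Expansion along a basis of the second factor: \<open>f b\<close> is the coordinate along \<open>b\<close>, zero for
  \<open>b\<close> outside the basis, and the coefficient of \<open>b\<close> is the slice \<open>(id \<otimes> f b) t\<close>. Because
  the coefficients are obtained from \<open>t\<close> by linear maps, linear conditions on \<open>t\<close> pass to
  them.\<close>

lemma tensor_slice_expansion:
  fixes t :: "('a::complex_vector, 'b::complex_vector) tensor"
  shows "\<exists>F f. finite F \<and> (\<forall>b. clinear (f b)) \<and>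
    t = (\<Sum>b\<in>F. tensor_lift (\<lambda>x y. f b y *\<^sub>C x) t \<otimes> b)"
proof -
  define B where "B = complex_vector.extend_basis ({} :: 'b set)"
  have B: "\<not> complex_vector.dependent B" "cspan B = UNIV"
    unfolding B_def
    by (rule complex_vector.independent_extend_basis complex_vector.span_extend_basis,
        rule complex_vector.independent_empty)+
  define f where "f b y = complex_vector.representation B y b" for b y
  have f: "clinear (f b)" for b
    unfolding f_def by (rule clinear_coordinate[OF B])
  define S where "S b = tensor_lift (\<lambda>(x::'a) y. f b y *\<^sub>C x)" for b
  have bil: "cbilinear (\<lambda>(x::'a) y. f b y *\<^sub>C x)" for b
    by (intro cbilinearI clinear_scaleC_left clinear_scaleC_right clinear_id f)
  have S: "clinear (S b)" and S_tens: "S b (x \<otimes> y) = f b y *\<^sub>C x" for b x y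
    using clinear_tensor_lift[OF bil] tensor_lift_tens[OF bil] by (simp_all add: S_def)
  \<comment> \<open>Allowing every finite set beyond some \<open>K\<close> lets the index sets of two summands be joined.\<close>
  have "\<exists>K. finite K \<and> (\<forall>F. finite F \<longrightarrow> K \<subseteq> F \<longrightarrow> t = (\<Sum>b\<in>F. S b t \<otimes> b))"
  proof (induction t rule: tensor_induct)
    case zero
    have "(0::'a) \<otimes> b = 0" for b :: 'b
      using clinear_zero[OF clinear_tens_left[OF clinear_id[where 'a = 'a]]] .
    then show ?case
      using clinear_zero[OF S] by (intro exI[of _ "{}"]) simp
  next
    case (add t x y)
    then obtain K where K: "finite K" "\<And>F. finite F \<Longrightarrow> K \<subseteq> F \<Longrightarrow> t = (\<Sum>b\<in>F. S b t \<otimes> b)"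
      by blast
    let ?K = "K \<union> {b. f b y \<noteq> 0}"
    have fin: "finite {b. f b y \<noteq> 0}"
      unfolding f_def by (rule complex_vector.finite_representation)
    have "t + x \<otimes> y = (\<Sum>b\<in>F. S b (t + x \<otimes> y) \<otimes> b)" if F: "finite F" "?K \<subseteq> F" for F
    proof -
      have "y = (\<Sum>b | f b y \<noteq> 0. f b y *\<^sub>C b)"
        using complex_vector.sum_nonzero_representation_eq[OF B(1), of y] B(2)
        by (simp add: f_def)
      also have "\<dots> = (\<Sum>b\<in>F. f b y *\<^sub>C b)"
        using F by (intro sum.mono_neutral_left) auto
      finally have "x \<otimes> y = x \<otimes> (\<Sum>b\<in>F. f b y *\<^sub>C b)"
        by (rule arg_cong)
      also have "\<dots> = (\<Sum>b\<in>F. x \<otimes> (f b y *\<^sub>C b))"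
        by (rule clinear_sum[OF clinear_tens_right[OF clinear_id]])
      also have "\<dots> = (\<Sum>b\<in>F. S b (x \<otimes> y) \<otimes> b)"
        by (simp add: S_tens tens_scaleC_left tens_scaleC_right)
      finally have "x \<otimes> y = (\<Sum>b\<in>F. S b (x \<otimes> y) \<otimes> b)" .
      moreover have "t = (\<Sum>b\<in>F. S b t \<otimes> b)"
        using K(2) F by blast
      moreover have "S b (t + x \<otimes> y) = S b t + S b (x \<otimes> y)" for b
        using S by (simp add: clinear_iff)
      ultimately show ?thesis
        by (simp add: tens_add_left sum.distrib)
    qed
    then show ?case
      using K(1) fin by (intro exI[of _ ?K]) blast
  qed
  then show ?thesis
    using f unfolding S_def by blast
qed

section \<open>Convolution\<close>

context module_algebra
begin

text \<open>The product of values is an arbitrary bilinear map \<open>d\<close>, so that the product of \<open>A\<close>, its left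
  action on \<open>A \<otimes> H\<close> and \<open>\<otimes>\<close> itself are covered alike and can be mixed in \<open>conv_assoc\<close>.\<close>

definition conv ::
  "('x::complex_vector \<Rightarrow> 'y::complex_vector \<Rightarrow> 'z::complex_vector) \<Rightarrow>
   ('h \<Rightarrow> 'x) \<Rightarrow> ('h \<Rightarrow> 'y) \<Rightarrow> 'h \<Rightarrow> 'z"
  where "conv d f g x = tensor_lift (\<lambda>x1 x2. d (f x1) (g x2)) (Delta x)"

lemma clinear_conv:
  assumes "cbilinear d" "clinear f" "clinear g"
  shows "clinear (conv d f g)"
  unfolding conv_def
  by (intro lin cbilinear_left[OF assms(1)] cbilinear_right[OF assms(1)] assms(2,3))

lemma clinear_apply_conv:
  assumes "clinear F" "cbilinear d" "clinear f" "clinear g"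
  shows "F (conv d f g x) = conv (\<lambda>u v. F (d u v)) f g x"
  unfolding conv_def
  by (intro clinear_tensor_lift_commute cbilinear_left[OF assms(2)]
      cbilinear_right[OF assms(2)] assms(1,3,4))

lemma conv_assoc:
  assumes "cbilinear d1" "cbilinear d2" "cbilinear d3" "cbilinear d4"
    and f: "clinear f" and g: "clinear g" and k: "clinear k"
    and "\<And>u v w. d1 (d2 u v) w = d3 u (d4 v w)"
  shows "conv d1 (conv d2 f g) k = conv d3 f (conv d4 g k)"
proof
  fix x
  note l1 = cbilinear_left[OF assms(1)] cbilinear_right[OF assms(1)]
  note l2 = cbilinear_left[OF assms(2)] cbilinear_right[OF assms(2)]
  note l3 = cbilinear_left[OF assms(3)] cbilinear_right[OF assms(3)]
  note l4 = cbilinear_left[OF assms(4)] cbilinear_right[OF assms(4)]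
  have "conv d1 (conv d2 f g) k x =
      tensor_lift (\<lambda>x1 x2. tensor_lift (\<lambda>u v. d1 (d2 (f u) (g v)) (k x2)) (Delta x1)) (Delta x)"
    unfolding conv_def
    by (subst clinear_tensor_lift_commute[where F = "\<lambda>t. d1 t (k y)" for y])
      (intro l1 l2 f g clinear_id refl)+
  also have "\<dots> = tensor_lift (\<lambda>x1 x2. tensor_lift (\<lambda>u v. d3 (f x1) (d4 (g u) (k v))) (Delta x2))
      (Delta x)"
    unfolding assms(8) by (rule coassoc_lift) (intro l3 l4 f g k)+
  also have "\<dots> = conv d3 f (conv d4 g k) x"
    unfolding conv_def
    by (subst clinear_tensor_lift_commute[where F = "\<lambda>t. d3 (f y) t" for y])
      (intro l3 l4 g k clinear_id refl)+
  finally show "conv d1 (conv d2 f g) k x = conv d3 f (conv d4 g k) x" .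
qed

lemma clinear_counit: "clinear counit"
  using counit_hom by (simp add: algebra_hom_def)

lemma conv_counit_left:
  assumes "cbilinear d" "clinear f"
  shows "conv d (\<lambda>x. counit x *\<^sub>C u) f x = d u (f x)"
proof -
  note l = cbilinear_left[OF assms(1)] cbilinear_right[OF assms(1)]
  have "conv d (\<lambda>x. counit x *\<^sub>C u) f x =
      tensor_lift (\<lambda>x1 x2. d u (f (counit x1 *\<^sub>C x2))) (Delta x)"
    using assms by (simp add: conv_def cbilinear_def clinear_iff)
  also have "\<dots> = d u (f (tensor_lift (\<lambda>x1 x2. counit x1 *\<^sub>C x2) (Delta x)))"
    by (rule clinear_tensor_lift_commute[symmetric])
      (intro l assms(2) clinear_scaleC_left clinear_scaleC_right clinear_counit clinear_id)+
  finally show ?thesis by (simp add: counit_left)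
qed

lemma conv_counit_right:
  assumes "cbilinear d" "clinear f"
  shows "conv d f (\<lambda>x. counit x *\<^sub>C u) x = d (f x) u"
proof -
  note l = cbilinear_left[OF assms(1)] cbilinear_right[OF assms(1)]
  have "conv d f (\<lambda>x. counit x *\<^sub>C u) x =
      tensor_lift (\<lambda>x1 x2. d (f (counit x2 *\<^sub>C x1)) u) (Delta x)"
    using assms by (simp add: conv_def cbilinear_def clinear_iff)
  also have "\<dots> = d (f (tensor_lift (\<lambda>x1 x2. counit x2 *\<^sub>C x1) (Delta x))) u"
    by (rule clinear_tensor_lift_commute[where F = "\<lambda>y. d (f y) u", symmetric])
      (intro l assms(2) clinear_scaleC_left clinear_scaleC_right clinear_counit clinear_id)+
  finally show ?thesis by (simp add: counit_right)
qed

text \<open>Multiplicativity of the comultiplication turns a convolution at a product into nested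
  convolutions in the separate factors, to which one-variable cancellation applies.\<close>

lemma conv_at_mult:
  assumes "cbilinear d" "clinear f" "clinear g"
  shows "conv d f g (x * y) =
    tensor_lift (\<lambda>x1 x2. tensor_lift (\<lambda>y1 y2. d (f (x1 * y1)) (g (x2 * y2))) (Delta y)) (Delta x)"
proof -
  note l = cbilinear_left[OF assms(1)] cbilinear_right[OF assms(1)]
  define F where "F = tensor_lift (\<lambda>u v. d (f u) (g v))"
  have bil: "cbilinear (\<lambda>u v. d (f u) (g v))"
    by (intro cbilinearI l assms)
  have F: "clinear F" and F_tens: "F (u \<otimes> v) = d (f u) (g v)" for u v
    using clinear_tensor_lift[OF bil] tensor_lift_tens[OF bil] by (simp_all add: F_def)
  have "Delta (x * y) = tensor_mult (Delta x) (Delta y)"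
    using Delta_hom by (simp add: algebra_hom_def)
  then have "conv d f g (x * y) = F (tensor_mult (Delta x) (Delta y))"
    by (simp add: conv_def F_def)
  also have "\<dots> = tensor_lift (\<lambda>x1 x2. F (tensor_lift (\<lambda>y1 y2. (x1 * y1) \<otimes> (x2 * y2)) (Delta y)))
      (Delta x)"
    unfolding tensor_mult_def by (rule clinear_tensor_lift_commute[OF F]) (intro lin)+
  also have "\<dots> = tensor_lift (\<lambda>x1 x2. tensor_lift (\<lambda>y1 y2. d (f (x1 * y1)) (g (x2 * y2))) (Delta y))
      (Delta x)"
    by (subst clinear_tensor_lift_commute[OF F]) (intro lin, intro lin, simp only: F_tens)
  finally show ?thesis .
qed

section \<open>Left multiplication by the module algebra and its commutant\<close>

abbreviation cross (infixl \<open>\<odot>\<close> 70)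
  where "x \<odot> y \<equiv> cross_mult Delta act x y"

abbreviation smult (infixr \<open>\<bullet>\<close> 71)
  where "a \<bullet> t \<equiv> (a \<otimes> 1) \<odot> t"

lemma bilinear_smult: "cbilinear (\<bullet>)"
  by (intro cbilinearI lin')

lemma cross_assoc: "x \<odot> y \<odot> z = x \<odot> (y \<odot> z)"
  using cross_mult_algebra by (simp add: unital_algebra_def)

lemma cross_one: "(1 \<otimes> 1) \<odot> x = x" "x \<odot> (1 \<otimes> 1) = x"
  using cross_mult_algebra by (simp_all add: unital_algebra_def)

lemma smult_tens: "a \<bullet> (b \<otimes> g) = (a * b) \<otimes> g"
  by (metis cross_assoc cross_mult_relations(1,2))

lemma smult_smult: "a \<bullet> b \<bullet> t = (a * b) \<bullet> t"
  by (metis cross_assoc cross_mult_relations(2))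

lemma tens_cross: "(a \<otimes> g) \<odot> (1 \<otimes> h) = a \<otimes> (g * h)"
  by (metis cross_assoc cross_mult_relations(1,3))

lemma cross_commute: "(1 \<otimes> g) \<odot> (a \<otimes> 1) = conv (\<otimes>) (\<lambda>g. act g a) (\<lambda>g. g) g"
  by (simp add: cross_mult_relations(4) cross_mult_relations(1) conv_def)

lemma act_linear: "clinear (\<lambda>g. act g a)"
  by (intro lin)

lemma smult_commute_tensI:
  fixes F :: "('a, 'h) tensor \<Rightarrow> ('a, 'h) tensor"
  assumes F: "clinear F" "\<And>a b g. F ((a * b) \<otimes> g) = a \<bullet> F (b \<otimes> g)"
  shows "F (a \<bullet> t) = a \<bullet> F t"
proof -
  have "(\<lambda>t. F (a \<bullet> t)) = (\<lambda>t. a \<bullet> F t)"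
    by (rule clinear_tensor_eqI) (intro lin' clinear_compose[OF F(1)] F(1), intro lin' F(1),
      simp add: smult_tens F(2))
  then show ?thesis by metis
qed

lemma commutant_iff: "c \<in> commutant Delta act \<longleftrightarrow> (\<forall>a. c \<odot> (a \<otimes> 1) = a \<bullet> c)"
  by (simp add: commutant_def)

lemma subspace_commutant: "csubspace (commutant Delta act)"
proof -
  have F: "clinear (\<lambda>x. x \<odot> (a \<otimes> 1))" "clinear (\<lambda>x. a \<bullet> x)" for a
    by (intro lin')+
  show ?thesis
    unfolding complex_vector.subspace_def commutant_iff
    using F clinear_zero[OF F(1)] clinear_zero[OF F(2)] by (simp add: clinear_iff commutant_iff)
qed

lemma subalgebra_commutant: "subalgebra (\<odot>) (1 \<otimes> 1) (commutant Delta act)"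
  unfolding subalgebra_def
proof (intro conjI ballI subspace_commutant)
  fix x y assume "x \<in> commutant Delta act" "y \<in> commutant Delta act"
  then show "x \<odot> y \<in> commutant Delta act"
    unfolding commutant_iff by (metis cross_assoc)
qed (simp add: commutant_iff cross_one)

end

section \<open>Convolution calculus of a splitting\<close>

locale split_cross_product = module_algebra Delta counit antipode act
  for Delta :: "'h::complex_algebra_1 \<Rightarrow> ('h, 'h) tensor"
    and counit :: "'h \<Rightarrow> complex"
    and antipode :: "'h \<Rightarrow> 'h"
    and act :: "'h \<Rightarrow> 'a::complex_algebra_1 \<Rightarrow> 'a" +
  fixes \<phi> :: "('a, 'h) tensor \<Rightarrow> 'a"
  assumes \<phi>_hom: "algebra_hom (cross_mult Delta act) (1 \<otimes> 1) (*) 1 \<phi>"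
    and \<phi>_retract: "\<phi> (a \<otimes> 1) = a"
begin

abbreviation \<zeta> :: "'h \<Rightarrow> ('a, 'h) tensor"
  where "\<zeta> \<equiv> zeta Delta antipode act \<phi>"

definition \<pi> :: "'h \<Rightarrow> 'a" where "\<pi> g = \<phi> (1 \<otimes> g)"

definition \<pi>' :: "'h \<Rightarrow> 'a" where "\<pi>' g = \<pi> (antipode g)"

lemma \<phi>_linear: "clinear \<phi>"
  and \<phi>_cross: "\<phi> (x \<odot> y) = \<phi> x * \<phi> y"
  using \<phi>_hom by (simp_all add: algebra_hom_def)

lemma pi_linear: "clinear \<pi>"
  unfolding \<pi>_def by (intro clinear_compose[OF \<phi>_linear] lin)

lemma pi'_linear: "clinear \<pi>'"
  unfolding \<pi>'_def by (intro clinear_compose[OF pi_linear] antipode_linear)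

lemmas pi_lin = pi_linear pi'_linear clinear_compose[OF pi_linear] clinear_compose[OF pi'_linear]

lemma pi_mult: "\<pi> (g * h) = \<pi> g * \<pi> h"
  by (metis \<phi>_cross cross_mult_relations(3) \<pi>_def)

lemma pi_one: "\<pi> 1 = 1"
  using \<phi>_hom by (simp add: \<pi>_def algebra_hom_def)

lemma \<phi>_tens: "\<phi> (a \<otimes> g) = a * \<pi> g"
  by (metis \<phi>_cross \<phi>_retract cross_mult_relations(1) \<pi>_def)

lemma conv_pi_pi': "conv (*) \<pi> \<pi>' = (\<lambda>g. counit g *\<^sub>C 1)"
proof
  fix g
  have "conv (*) \<pi> \<pi>' g = \<pi> (conv (*) (\<lambda>g. g) antipode g)"
    using clinear_apply_conv[OF pi_linear bilinear_mult clinear_id antipode_linear]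
    by (simp add: conv_def \<pi>'_def pi_mult)
  then show "conv (*) \<pi> \<pi>' g = counit g *\<^sub>C 1"
    using pi_linear by (simp add: conv_def antipode_right pi_one clinear_iff)
qed

lemma conv_pi'_pi: "conv (*) \<pi>' \<pi> = (\<lambda>g. counit g *\<^sub>C 1)"
proof
  fix g
  have "conv (*) \<pi>' \<pi> g = \<pi> (conv (*) antipode (\<lambda>g. g) g)"
    using clinear_apply_conv[OF pi_linear bilinear_mult antipode_linear clinear_id]
    by (simp add: conv_def \<pi>'_def pi_mult)
  then show "conv (*) \<pi>' \<pi> g = counit g *\<^sub>C 1"
    using pi_linear by (simp add: conv_def antipode_left pi_one clinear_iff)
qed

text \<open>Convolution by \<open>\<pi>\<close> from the left is a bijection on linear maps into \<open>A \<otimes> H\<close>, with inverse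
  the convolution by \<open>\<pi>'\<close>; in particular \<open>\<pi>\<close> can be cancelled.\<close>

lemma conv_pi_pi'_smult:
  assumes "clinear f"
  shows "conv (\<bullet>) \<pi> (conv (\<bullet>) \<pi>' f) = f"
proof -
  have "conv (\<bullet>) \<pi> (conv (\<bullet>) \<pi>' f) = conv (\<bullet>) (conv (*) \<pi> \<pi>') f"
    by (rule conv_assoc[symmetric])
      (intro bilinear_smult bilinear_mult pi_lin assms smult_smult[symmetric])+
  then show ?thesis
    by (simp add: conv_pi_pi' conv_counit_left[OF bilinear_smult assms] cross_one fun_eq_iff)
qed

lemma conv_pi'_pi_smult:
  assumes "clinear f"
  shows "conv (\<bullet>) \<pi>' (conv (\<bullet>) \<pi> f) = f"
proof -
  have "conv (\<bullet>) \<pi>' (conv (\<bullet>) \<pi> f) = conv (\<bullet>) (conv (*) \<pi>' \<pi>) f"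
    by (rule conv_assoc[symmetric])
      (intro bilinear_smult bilinear_mult pi_lin assms smult_smult[symmetric])+
  then show ?thesis
    by (simp add: conv_pi'_pi conv_counit_left[OF bilinear_smult assms] cross_one fun_eq_iff)
qed

text \<open>The image of the cross relation \<open>g a = (g\<^sub>(\<^sub>1\<^sub>) \<triangleright> a) g\<^sub>(\<^sub>2\<^sub>)\<close> under \<open>\<phi>\<close>.\<close>

lemma conv_act_pi: "conv (*) (\<lambda>g. act g a) \<pi> = (\<lambda>g. \<pi> g * a)"
proof
  fix g
  have "\<pi> g * a = \<phi> ((1 \<otimes> g) \<odot> (a \<otimes> 1))"
    by (simp add: \<phi>_cross \<phi>_retract \<pi>_def)
  also have "\<dots> = conv (\<lambda>b h. \<phi> (b \<otimes> h)) (\<lambda>g. act g a) (\<lambda>g. g) g"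
    unfolding cross_commute
    by (rule clinear_apply_conv[OF \<phi>_linear cbilinear_tens act_linear clinear_id])
  finally show "conv (*) (\<lambda>g. act g a) \<pi> g = \<pi> g * a"
    by (simp add: conv_def \<phi>_tens)
qed

text \<open>Conjugating \<open>conv_act_pi\<close> by \<open>\<pi>'\<close>:
  \<open>\<pi>' g\<^sub>(\<^sub>1\<^sub>) (g\<^sub>(\<^sub>2\<^sub>) \<triangleright> a) = \<pi>' g\<^sub>(\<^sub>1\<^sub>) (g\<^sub>(\<^sub>2\<^sub>) \<triangleright> a) \<pi> g\<^sub>(\<^sub>3\<^sub>) \<pi>' g\<^sub>(\<^sub>4\<^sub>) =
  \<pi>' g\<^sub>(\<^sub>1\<^sub>) \<pi> g\<^sub>(\<^sub>2\<^sub>) a \<pi>' g\<^sub>(\<^sub>3\<^sub>) = a \<pi>' g\<close>.\<close>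

lemma conv_pi'_act: "conv (*) \<pi>' (\<lambda>g. act g a) = (\<lambda>g. a * \<pi>' g)"
proof
  fix g
  let ?action = "\<lambda>g. act g a"
  note assoc = conv_assoc[OF bilinear_mult bilinear_mult bilinear_mult bilinear_mult]
  have pi_act: "clinear (conv (*) \<pi>' ?action)"
    by (intro clinear_conv bilinear_mult pi'_linear act_linear)
  have "conv (*) \<pi>' ?action g = conv (*) (conv (*) \<pi>' ?action) (\<lambda>g. counit g *\<^sub>C 1) g"
    by (simp add: conv_counit_right[OF bilinear_mult pi_act])
  also have "\<dots> = conv (*) (conv (*) \<pi>' ?action) (conv (*) \<pi> \<pi>') g"
    by (simp add: conv_pi_pi')
  also have "\<dots> = conv (*) (conv (*) (conv (*) \<pi>' ?action) \<pi>) \<pi>' g"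
    by (subst assoc)
      (intro pi_act pi_lin, intro pi_act pi_lin, intro pi_act pi_lin, rule mult.assoc, rule refl)
  also have "conv (*) (conv (*) \<pi>' ?action) \<pi> = conv (*) \<pi>' (\<lambda>g. \<pi> g * a)"
    by (subst assoc) (intro act_linear pi_lin, intro act_linear pi_lin, intro act_linear pi_lin,
      rule mult.assoc, simp only: conv_act_pi)
  also have "\<dots> = (\<lambda>g. counit g *\<^sub>C a)"
  proof
    fix g
    have "conv (*) \<pi>' (\<lambda>g. \<pi> g * a) g = conv (*) \<pi>' \<pi> g * a"
      unfolding clinear_apply_conv[OF clinear_mult_left[OF clinear_id] bilinear_mult
          pi'_linear pi_linear]
      by (simp add: conv_def mult.assoc)
    then show "conv (*) \<pi>' (\<lambda>g. \<pi> g * a) g = counit g *\<^sub>C a"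
      by (simp add: conv_pi'_pi scaleC_mult_left)
  qed
  finally show "conv (*) \<pi>' ?action g = a * \<pi>' g"
    by (simp add: conv_counit_left[OF bilinear_mult pi'_linear])
qed

section \<open>The homomorphism into the commutant\<close>

lemma zeta_conv: "\<zeta> = conv (\<otimes>) \<pi>' (\<lambda>g. g)"
  by (simp add: fun_eq_iff zeta_def conv_def \<pi>'_def \<pi>_def cross_mult_relations(1))

text \<open>The same convolution read through the left action of \<open>A\<close> on \<open>A \<otimes> H\<close>, the form in which
  \<open>\<pi>\<close> and \<open>\<pi>'\<close> cancel.\<close>

lemma zeta_conv_smult: "\<zeta> = conv (\<bullet>) \<pi>' (\<lambda>g. 1 \<otimes> g)"
  by (simp add: fun_eq_iff zeta_def conv_def \<pi>'_def \<pi>_def)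

lemma zeta_linear: "clinear \<zeta>"
  unfolding zeta_conv by (intro clinear_conv cbilinear_tens pi'_linear clinear_id)

lemma conv_pi_zeta: "conv (\<bullet>) \<pi> \<zeta> = (\<lambda>g. 1 \<otimes> g)"
  unfolding zeta_conv_smult by (intro conv_pi_pi'_smult lin)

text \<open>Moving \<open>a\<close> to the left past \<open>g\<^sub>(\<^sub>2\<^sub>)\<close> creates \<open>\<pi>' g\<^sub>(\<^sub>1\<^sub>) (g\<^sub>(\<^sub>2\<^sub>) \<triangleright> a) \<otimes> g\<^sub>(\<^sub>3\<^sub>)\<close>, and
  \<open>conv_pi'_act\<close> applies to the first factor.\<close>

lemma zeta_commutes: "\<zeta> g \<odot> (a \<otimes> 1) = a \<bullet> \<zeta> g"
proof -
  let ?action = "\<lambda>g. act g a"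
  have "\<zeta> g \<odot> (a \<otimes> 1) = conv (\<lambda>x t. (x \<bullet> t) \<odot> (a \<otimes> 1)) \<pi>' (\<lambda>g. 1 \<otimes> g) g"
    unfolding zeta_conv_smult
    by (rule clinear_apply_conv) (intro lin' bilinear_smult pi'_linear)+
  also have "\<dots> = conv (\<bullet>) \<pi>' (conv (\<otimes>) ?action (\<lambda>g. g)) g"
    by (simp add: conv_def[of _ \<pi>'] cross_assoc cross_commute)
  also have "\<dots> = conv (\<otimes>) (conv (*) \<pi>' ?action) (\<lambda>g. g) g"
    by (subst conv_assoc[where ?d3.0 = "(\<bullet>)" and ?d4.0 = "(\<otimes>)"])
      (intro bilinear_smult bilinear_mult cbilinear_tens pi'_linear act_linear clinear_id refl
        smult_tens[symmetric])+
  also have "\<dots> = conv (\<lambda>x y. a \<bullet> (x \<otimes> y)) \<pi>' (\<lambda>g. g) g"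
    by (simp add: conv_pi'_act smult_tens) (simp add: conv_def)
  also have "\<dots> = a \<bullet> \<zeta> g"
    unfolding zeta_conv
    by (rule clinear_apply_conv[symmetric]) (intro lin' cbilinear_tens pi'_linear)+
  finally show ?thesis .
qed

lemma zeta_one: "\<zeta> 1 = 1 \<otimes> 1"
proof -
  have "Delta 1 = 1 \<otimes> 1"
    using Delta_hom by (simp add: algebra_hom_def)
  then have one: "conv d f g 1 = d (f 1) (g 1)"
    if "cbilinear d" "clinear f" "clinear g"
    for d :: "'x::complex_vector \<Rightarrow> 'y::complex_vector \<Rightarrow> 'z::complex_vector" and f g
    unfolding conv_def
    by (simp, intro tensor_lift_tens cbilinearI
        cbilinear_left[OF that(1)] cbilinear_right[OF that(1)] that(2,3))
  have "\<pi> 1 \<bullet> \<zeta> 1 = 1 \<otimes> 1"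
    using conv_pi_zeta one[OF bilinear_smult pi_linear zeta_linear] by (simp add: fun_eq_iff)
  then show ?thesis by (simp add: pi_one cross_one)
qed

text \<open>By \<open>zeta_commutes\<close>, \<open>\<zeta> g \<zeta> h = \<pi>' h\<^sub>(\<^sub>1\<^sub>) \<zeta> g h\<^sub>(\<^sub>2\<^sub>)\<close>, so cancelling \<open>\<pi>'\<close> the claim becomes
  \<open>\<pi> h\<^sub>(\<^sub>1\<^sub>) \<zeta> (g h\<^sub>(\<^sub>2\<^sub>)) = \<zeta> g h\<close>. Convolving both sides with \<open>\<pi>\<close> in the variable \<open>g\<close> turns the
  left one into \<open>\<pi> (g\<^sub>(\<^sub>1\<^sub>) h\<^sub>(\<^sub>1\<^sub>)) \<zeta> (g\<^sub>(\<^sub>2\<^sub>) h\<^sub>(\<^sub>2\<^sub>))\<close>, and then both are \<open>1 \<otimes> g h\<close> by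
  \<open>conv_pi_zeta\<close>.\<close>

lemma zeta_mult: "\<zeta> (g * h) = \<zeta> g \<odot> \<zeta> h"
proof -
  define L where "L g h = conv (\<bullet>) \<pi> (\<lambda>h. \<zeta> (g * h)) h" for g h
  have zeta_right: "clinear (\<lambda>h. \<zeta> (g * h))" for g
    by (intro clinear_compose[OF zeta_linear] lin)
  have L: "clinear (\<lambda>g. L g h)" for h
    unfolding L_def conv_def
    by (intro lin' pi_linear clinear_compose[OF zeta_linear])
  have "conv (\<bullet>) \<pi> (\<lambda>g. L g h) = conv (\<bullet>) \<pi> (\<lambda>g. \<zeta> g \<odot> (1 \<otimes> h))" for h
  proof
    fix g
    have "conv (\<bullet>) \<pi> (\<lambda>g. L g h) g = tensor_lift (\<lambda>g1 g2.
        tensor_lift (\<lambda>h1 h2. \<pi> g1 \<bullet> \<pi> h1 \<bullet> \<zeta> (g2 * h2)) (Delta h)) (Delta g)"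
      unfolding L_def conv_def
      by (subst clinear_tensor_lift_commute[where F = "\<lambda>t. \<pi> y \<bullet> t" for y])
        (intro lin' pi_lin clinear_compose[OF zeta_linear] refl)+
    also have "\<dots> = conv (\<bullet>) \<pi> \<zeta> (g * h)"
      unfolding conv_at_mult[OF bilinear_smult pi_linear zeta_linear]
      by (simp only: pi_mult smult_smult)
    also have "\<dots> = conv (\<bullet>) \<pi> \<zeta> g \<odot> (1 \<otimes> h)"
      by (simp add: conv_pi_zeta tens_cross)
    also have "\<dots> = conv (\<bullet>) \<pi> (\<lambda>g. \<zeta> g \<odot> (1 \<otimes> h)) g"
      unfolding clinear_apply_conv[OF clinear_cross_mult_left[OF clinear_id] bilinear_smult
          pi_linear zeta_linear]
      by (simp add: conv_def cross_assoc)
    finally show "conv (\<bullet>) \<pi> (\<lambda>g. L g h) g = conv (\<bullet>) \<pi> (\<lambda>g. \<zeta> g \<odot> (1 \<otimes> h)) g" .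
  qed
  then have "(\<lambda>g. L g h) = (\<lambda>g. \<zeta> g \<odot> (1 \<otimes> h))" for h
    using conv_pi'_pi_smult[OF L] conv_pi'_pi_smult[OF clinear_cross_mult_left[OF zeta_linear]]
    by metis
  then have *: "conv (\<bullet>) \<pi> (\<lambda>h. \<zeta> (g * h)) = (\<lambda>h. \<zeta> g \<odot> (1 \<otimes> h))"
    unfolding L_def by metis
  have "\<zeta> (g * h) = conv (\<bullet>) \<pi>' (\<lambda>h. \<zeta> g \<odot> (1 \<otimes> h)) h"
    using conv_pi'_pi_smult[OF zeta_right[of g], THEN fun_cong, of h] by (simp only: *)
  also have "\<dots> = conv (\<lambda>x t. \<zeta> g \<odot> x \<bullet> t) \<pi>' (\<lambda>h. 1 \<otimes> h) h"
    by (simp add: conv_def cross_assoc[symmetric] zeta_commutes)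
  also have "\<dots> = \<zeta> g \<odot> \<zeta> h"
    unfolding zeta_conv_smult[THEN fun_cong, of h]
    by (rule clinear_apply_conv[symmetric]) (intro lin' bilinear_smult pi'_linear)+
  finally show ?thesis .
qed

section \<open>The cross-product and the commutant as modules over the image\<close>

definition zeta_iso :: "('a, 'h) tensor \<Rightarrow> ('a, 'h) tensor"
  where "zeta_iso = tensor_lift (\<lambda>x h. x \<bullet> \<zeta> h)"

definition zeta_iso_inv :: "('a, 'h) tensor \<Rightarrow> ('a, 'h) tensor"
  where "zeta_iso_inv = tensor_lift (\<lambda>x h. x \<bullet> conv (\<otimes>) \<pi> (\<lambda>g. g) h)"

lemma conv_pi_linear: "clinear (conv (\<otimes>) \<pi> (\<lambda>g. g))"
  by (intro clinear_conv cbilinear_tens pi_linear clinear_id)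

lemma zeta_iso_linear: "clinear zeta_iso" and zeta_iso_tens: "zeta_iso (x \<otimes> h) = x \<bullet> \<zeta> h"
proof -
  have "cbilinear (\<lambda>x h. x \<bullet> \<zeta> h)"
    by (intro cbilinearI lin' zeta_linear)
  then show "clinear zeta_iso" "zeta_iso (x \<otimes> h) = x \<bullet> \<zeta> h"
    by (simp_all add: zeta_iso_def clinear_tensor_lift tensor_lift_tens)
qed

lemma zeta_iso_inv_linear: "clinear zeta_iso_inv"
  and zeta_iso_inv_tens: "zeta_iso_inv (x \<otimes> h) = x \<bullet> conv (\<otimes>) \<pi> (\<lambda>g. g) h"
proof -
  have "cbilinear (\<lambda>x h. x \<bullet> conv (\<otimes>) \<pi> (\<lambda>g. g) h)"
    by (intro cbilinearI lin' conv_pi_linear)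
  then show "clinear zeta_iso_inv" "zeta_iso_inv (x \<otimes> h) = x \<bullet> conv (\<otimes>) \<pi> (\<lambda>g. g) h"
    by (simp_all add: zeta_iso_inv_def clinear_tensor_lift tensor_lift_tens)
qed

lemma zeta_iso_smult: "zeta_iso (a \<bullet> t) = a \<bullet> zeta_iso t"
  by (intro smult_commute_tensI zeta_iso_linear) (simp add: zeta_iso_tens smult_smult)

lemma zeta_iso_inv_smult: "zeta_iso_inv (a \<bullet> t) = a \<bullet> zeta_iso_inv t"
  by (intro smult_commute_tensI zeta_iso_inv_linear) (simp add: zeta_iso_inv_tens smult_smult)

text \<open>Both composites are left \<open>A\<close>-linear, so they need to be compared with the identity only on
  \<open>1 \<otimes> h\<close>, where the convolutions of \<open>\<pi>'\<close> and \<open>\<pi>\<close> cancel.\<close>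

lemma zeta_iso_inv_zeta_iso: "zeta_iso_inv (zeta_iso t) = t"
proof -
  have "zeta_iso_inv (\<zeta> h) = 1 \<otimes> h" for h
  proof -
    have "zeta_iso_inv (\<zeta> h) = conv (\<bullet>) \<pi>' (conv (\<otimes>) \<pi> (\<lambda>g. g)) h"
      unfolding zeta_conv clinear_apply_conv[OF zeta_iso_inv_linear cbilinear_tens pi'_linear clinear_id]
      by (simp add: conv_def[of _ \<pi>'] zeta_iso_inv_tens)
    also have "\<dots> = conv (\<otimes>) (conv (*) \<pi>' \<pi>) (\<lambda>g. g) h"
      by (subst conv_assoc[where ?d3.0 = "(\<bullet>)" and ?d4.0 = "(\<otimes>)"])
        (intro bilinear_smult bilinear_mult cbilinear_tens pi_lin clinear_id refl
          smult_tens[symmetric])+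
    finally show ?thesis
      by (simp add: conv_pi'_pi conv_counit_left[OF cbilinear_tens clinear_id])
  qed
  then have "(\<lambda>t. zeta_iso_inv (zeta_iso t)) = (\<lambda>t. t)"
    by (intro clinear_tensor_eqI clinear_compose[OF zeta_iso_inv_linear] zeta_iso_linear clinear_id)
      (simp add: zeta_iso_tens zeta_iso_inv_smult smult_tens)
  then show ?thesis by metis
qed

lemma zeta_iso_zeta_iso_inv: "zeta_iso (zeta_iso_inv t) = t"
proof -
  have "zeta_iso (conv (\<otimes>) \<pi> (\<lambda>g. g) h) = 1 \<otimes> h" for h
    unfolding clinear_apply_conv[OF zeta_iso_linear cbilinear_tens pi_linear clinear_id]
    using conv_pi_zeta by (simp add: fun_eq_iff conv_def zeta_iso_tens)
  then have "(\<lambda>t. zeta_iso (zeta_iso_inv t)) = (\<lambda>t. t)"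
    by (intro clinear_tensor_eqI clinear_compose[OF zeta_iso_linear] zeta_iso_inv_linear clinear_id)
      (simp add: zeta_iso_inv_tens zeta_iso_smult smult_tens)
  then show ?thesis by metis
qed

lemma inj_zeta: "inj \<zeta>"
proof (rule injI)
  fix g h assume "\<zeta> g = \<zeta> h"
  then have "\<zeta> (g - h) = 0"
    using clinear_diff[OF zeta_linear] by simp
  then have "zeta_iso (1 \<otimes> (g - h)) = 0"
    by (simp add: zeta_iso_tens cross_one)
  then have "1 \<otimes> (g - h) = (0 :: ('a, 'h) tensor)"
    by (metis zeta_iso_inv_zeta_iso zeta_iso_inv_linear clinear_zero)
  then show "g = h"
    using tens_eq_zero_right[of "1::'a" "g - h"] by simp
qed

lemma zeta_commutant: "\<zeta> g \<in> commutant Delta act"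
  by (simp add: commutant_iff zeta_commutes)

text \<open>The map \<open>zeta_iso\<close> transports right multiplication by \<open>a\<close> to \<open>x \<otimes> h \<mapsto> x a \<otimes> h\<close> (the map
  \<open>R\<close> below), since \<open>\<zeta> h\<close> commutes with \<open>a\<close>, and left multiplication by \<open>a\<close> to itself. A tensor
  \<open>t\<close> with image in the commutant is therefore one on which these two agree, and slicing turns the
  agreement into centrality.\<close>

lemma central_slices:
  assumes t: "zeta_iso t \<in> commutant Delta act" and f: "clinear f"
  shows "tensor_lift (\<lambda>x h. f h *\<^sub>C x) t \<in> center"
proof -
  define S where "S = tensor_lift (\<lambda>(x::'a) h. f h *\<^sub>C x)"
  have bil: "cbilinear (\<lambda>(x::'a) h. f h *\<^sub>C x)"
    by (intro cbilinearI clinear_scaleC_left clinear_scaleC_right clinear_id f)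
  have S: "clinear S" and S_tens: "S (x \<otimes> h) = f h *\<^sub>C x" for x h
    using clinear_tensor_lift[OF bil] tensor_lift_tens[OF bil] by (simp_all add: S_def)
  have "S t * a = a * S t" for a
  proof -
    define R where "R = tensor_lift (\<lambda>x h. (x * a) \<otimes> (h :: 'h))"
    have bilR: "cbilinear (\<lambda>x h. (x * a) \<otimes> (h :: 'h))"
      by (intro cbilinearI lin)
    have R: "clinear R" and R_tens: "R (x \<otimes> h) = (x * a) \<otimes> h" for x h
      using clinear_tensor_lift[OF bilR] tensor_lift_tens[OF bilR] by (simp_all add: R_def)
    have "(\<lambda>t. zeta_iso t \<odot> (a \<otimes> 1)) = (\<lambda>t. zeta_iso (R t))"
    proof (rule clinear_tensor_eqI)
      show "zeta_iso (x \<otimes> h) \<odot> (a \<otimes> 1) = zeta_iso (R (x \<otimes> h))" for x h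
        by (simp add: zeta_iso_tens R_tens cross_assoc zeta_commutes smult_smult)
    qed (intro lin' zeta_iso_linear clinear_compose[OF zeta_iso_linear] R)+
    then have "zeta_iso (R t) = zeta_iso (a \<bullet> t)"
      using t unfolding commutant_iff zeta_iso_smult by metis
    then have Rt: "R t = a \<bullet> t"
      by (metis zeta_iso_inv_zeta_iso)
    have "(\<lambda>t. S (R t)) = (\<lambda>t. S t * a)"
      by (rule clinear_tensor_eqI)
        (intro clinear_compose[OF S] R, intro lin S, simp add: S_tens R_tens scaleC_mult_left)
    moreover have "(\<lambda>t. S (a \<bullet> t)) = (\<lambda>t. a * S t)"
      by (rule clinear_tensor_eqI)
        (intro clinear_compose[OF S] lin', intro lin S,
          simp add: S_tens smult_tens scaleC_mult_right)
    ultimately show ?thesis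
      using Rt by metis
  qed
  then show ?thesis
    by (simp add: center_def S_def)
qed

lemma commutant_eq:
  "commutant Delta act = span_mult (\<odot>) ((\<lambda>z. z \<otimes> 1) ` center) (range \<zeta>)"
proof
  show "span_mult (\<odot>) ((\<lambda>z. z \<otimes> 1) ` center) (range \<zeta>) \<subseteq> commutant Delta act"
    unfolding span_mult_def
  proof (rule complex_vector.span_minimal[OF _ subspace_commutant], clarify)
    fix z :: 'a and g assume "z \<in> center"
    then have "z \<otimes> 1 \<in> commutant Delta act"
      by (simp add: commutant_iff center_def smult_tens)
    then show "z \<bullet> \<zeta> g \<in> commutant Delta act"
      using subalgebra_commutant zeta_commutant unfolding subalgebra_def by blast
  qed
next
  show "commutant Delta act \<subseteq> span_mult (\<odot>) ((\<lambda>z. z \<otimes> 1) ` center) (range \<zeta>)"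
  proof
    fix c assume c: "c \<in> commutant Delta act"
    obtain F f where f: "\<And>b. clinear (f b)"
      and slices: "zeta_iso_inv c = (\<Sum>b\<in>F. tensor_lift (\<lambda>x h. f b h *\<^sub>C x) (zeta_iso_inv c) \<otimes> b)"
      using tensor_slice_expansion by blast
    define z where "z b = tensor_lift (\<lambda>x h. f b h *\<^sub>C x) (zeta_iso_inv c)" for b
    have z: "z b \<in> center" for b
      unfolding z_def using c f by (intro central_slices) (simp_all add: zeta_iso_zeta_iso_inv)
    have "zeta_iso_inv c = (\<Sum>b\<in>F. z b \<otimes> b)"
      unfolding z_def by (rule slices)
    then have "c = zeta_iso (\<Sum>b\<in>F. z b \<otimes> b)"
      by (metis zeta_iso_zeta_iso_inv)
    also have "\<dots> = (\<Sum>b\<in>F. z b \<bullet> \<zeta> b)"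
      by (simp add: clinear_sum[OF zeta_iso_linear] zeta_iso_tens)
    also have "\<dots> \<in> span_mult (\<odot>) ((\<lambda>z. z \<otimes> 1) ` center) (range \<zeta>)"
      unfolding span_mult_def
      by (intro complex_vector.span_sum complex_vector.span_base) (use z in blast)
    finally show "c \<in> span_mult (\<odot>) ((\<lambda>z. z \<otimes> 1) ` center) (range \<zeta>)" .
  qed
qed

lemma cross_product_eq: "UNIV = span_mult (\<odot>) (range (\<lambda>a. a \<otimes> 1)) (range \<zeta>)"
proof -
  have "zeta_iso t \<in> span_mult (\<odot>) (range (\<lambda>a. a \<otimes> 1)) (range \<zeta>)" for t
  proof (induction t rule: tensor_induct)
    case zero
    show ?case
      unfolding span_mult_def clinear_zero[OF zeta_iso_linear] by (rule complex_vector.span_zero)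
  next
    case (add t a g)
    have "a \<bullet> \<zeta> g \<in> span_mult (\<odot>) (range (\<lambda>a. a \<otimes> 1)) (range \<zeta>)"
      unfolding span_mult_def by (rule complex_vector.span_base) blast
    moreover have "zeta_iso (t + a \<otimes> g) = zeta_iso t + a \<bullet> \<zeta> g"
      using zeta_iso_linear by (simp add: clinear_iff zeta_iso_tens)
    ultimately show ?case
      using complex_vector.span_add[OF add[unfolded span_mult_def]] unfolding span_mult_def
      by simp
  qed
  then have "t \<in> span_mult (\<odot>) (range (\<lambda>a. a \<otimes> 1)) (range \<zeta>)" for t
    using zeta_iso_zeta_iso_inv[of t] by metis
  then show ?thesis by blast
qed

text \<open>A scalar \<open>c\<close> can be absorbed into the second factor, \<open>c \<zeta> g = \<zeta> (c g)\<close>, and the range of a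
  linear map is its own span.\<close>

lemma commutant_eq_range:
  assumes "(center :: 'a set) = range (\<lambda>c. c *\<^sub>C 1)"
  shows "commutant Delta act = range \<zeta>"
proof
  show "range \<zeta> \<subseteq> commutant Delta act"
    using zeta_commutant by blast
  have "(c *\<^sub>C 1) \<bullet> \<zeta> g = \<zeta> (c *\<^sub>C g)" for c g
  proof -
    have "clinear (\<lambda>x. x \<odot> \<zeta> g)"
      by (intro lin')
    then show ?thesis
      using zeta_linear by (simp add: tens_scaleC_left clinear_iff cross_one)
  qed
  moreover have "csubspace (range \<zeta>)"
    unfolding complex_vector.subspace_def
  proof (intro conjI ballI allI)
    show "0 \<in> range \<zeta>"
      by (rule range_eqI[where x = 0]) (rule clinear_zero[OF zeta_linear, symmetric])
  next
    fix x y assume "x \<in> range \<zeta>" "y \<in> range \<zeta>"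
    then obtain g h where "x = \<zeta> g" "y = \<zeta> h"
      by blast
    then have "x + y = \<zeta> (g + h)"
      using zeta_linear by (simp add: clinear_iff)
    then show "x + y \<in> range \<zeta>"
      by simp
  next
    fix c x assume "x \<in> range \<zeta>"
    then obtain g where "x = \<zeta> g"
      by blast
    then have "c *\<^sub>C x = \<zeta> (c *\<^sub>C g)"
      using zeta_linear by (simp add: clinear_iff)
    then show "c *\<^sub>C x \<in> range \<zeta>"
      by simp
  qed
  ultimately show "commutant Delta act \<subseteq> range \<zeta>"
    unfolding commutant_eq span_mult_def assms
    by (intro complex_vector.span_minimal) auto
qed

end

theorem theorem1:
  fixes Delta :: "'h::complex_algebra_1 \<Rightarrow> ('h, 'h) tensor"
    and counit :: "'h \<Rightarrow> complex"
    and antipode :: "'h \<Rightarrow> 'h"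
    and act :: "'h \<Rightarrow> 'a::complex_algebra_1 \<Rightarrow> 'a"
    and \<phi> :: "('a, 'h) tensor \<Rightarrow> 'a"
  assumes "hopf_algebra Delta counit antipode"
    and "module_algebra Delta counit antipode act"
    and "algebra_hom (cross_mult Delta act) (1 \<otimes> 1) (*) 1 \<phi>"
    and "\<forall>a. \<phi> (a \<otimes> 1) = a"
  shows "subalgebra (cross_mult Delta act) (1 \<otimes> 1) (commutant Delta act) \<and>
    algebra_hom (*) 1 (cross_mult Delta act) (1 \<otimes> 1) (zeta Delta antipode act \<phi>) \<and>
    range (zeta Delta antipode act \<phi>) \<subseteq> commutant Delta act \<and>
    inj (zeta Delta antipode act \<phi>) \<and>
    commutant Delta act =
      span_mult (cross_mult Delta act) ((\<lambda>z. z \<otimes> 1) ` center)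
        (range (zeta Delta antipode act \<phi>)) \<and>
    UNIV =
      span_mult (cross_mult Delta act) (range (\<lambda>a. a \<otimes> 1))
        (range (zeta Delta antipode act \<phi>)) \<and>
    ((center :: 'a set) = range (\<lambda>c. c *\<^sub>C 1) \<longrightarrow>
      commutant Delta act = range (zeta Delta antipode act \<phi>) \<and>
      bij_betw (zeta Delta antipode act \<phi>) UNIV (commutant Delta act))"
proof -
  interpret split_cross_product Delta counit antipode act \<phi>
    using assms by (simp add: split_cross_product_def split_cross_product_axioms_def)
  have "algebra_hom (*) 1 (\<odot>) (1 \<otimes> 1) \<zeta>"
    by (simp add: algebra_hom_def zeta_linear zeta_mult zeta_one)
  moreover have "range \<zeta> \<subseteq> commutant Delta act"
    using zeta_commutant by blast
  moreover have "bij_betw \<zeta> UNIV (commutant Delta act)"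
    if "(center :: 'a set) = range (\<lambda>c. c *\<^sub>C 1)"
    using commutant_eq_range[OF that] inj_zeta by (simp add: bij_betw_def)
  ultimately show ?thesis
    using subalgebra_commutant inj_zeta commutant_eq cross_product_eq commutant_eq_range
    by simp
qed

end
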